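(* Let $A$ be an $n\times n$ nonsingular $M$-matrix with diagonal entries $a_1,\dots,a_n$, let $D=\mathrm{diag}(a_1,\dots,a_n)$ and $B=D-A$ (so all entries of $B$ are non-negative and its diagonal is zero), and let $\alpha>0$. Let $Z=(Z_1,\dots,Z_n)$ be an $\mathbb{N}^n$-valued random variable with $$P\left(Z=(k_1,\dots,k_n)\right)=\frac{|A|^\alpha}{\prod_{i=1}^na_i^\alpha}\,\frac{|B(\mathbf{k})|_\alpha}{\prod_{i=1}^na_i^{k_i}k_i!},\qquad \mathbf{k}=(k_1,\dots,k_n)\in\mathbb{N}^n,$$ and let $X=(X_1,\dots,X_n)$ with $$X=\left(\xi^{(Z,1)}_{\alpha+Z_1,a_1},\dots,\xi^{(Z,n)}_{\alpha+Z_n,a_n}\right)=\sum_{\mathbf{k}=(k_1,\dots,k_n)\in\mathbb{N}^n}1_{\{Z=(k_1,\dots,k_n)\}}\left(\xi^{(\mathbf{k},1)}_{\alpha+k_1,a_1},\dots,\xi^{(\mathbf{k},n)}_{\alpha+k_n,a_n}\right),$$ where $Z$ and all the gamma distributed random variables $\xi^{(\mathbf{k},i)}_{\alpha+k_i,a_i}$, $\mathbf{k}\in\mathbb{N}^n$, $i\in\{1,\dots,n\}$, are independent. Then for all $s_1,\dots,s_n\ge0$, with $S=\mathrm{diag}(s_1,\dots,s_n)$, $$E\left(e^{-\sum_{i=1}^ns_iX_i}\right)=\frac{|A|^\alpha}{|A+S|^\alpha}.$$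
   Context: $|A|$ denotes the determinant of $A$, and $\mathbb{N}=\{0,1,2,\dots\}$. A real $n\times n$ matrix $A=(a_{i,j})$ is a nonsingular $M$-matrix if $a_{i,j}\le0$ for $i\ne j$, $A$ is nonsingular, and all entries of $A^{-1}$ are $\ge0$. For $u,v>0$, $\xi_{u,v}$ (with any superscript) denotes a gamma random variable with density $v^ux^{u-1}e^{-vx}/\Gamma(u)$ on $x>0$. For an $m\times m$ matrix $M=(m_{i,j})$ the $\alpha$-permanent is $|M|_\alpha=\sum_\pi\alpha^{c(\pi)}m_{1,\pi(1)}m_{2,\pi(2)}\cdots m_{m,\pi(m)}$, the sum over all permutations $\pi$ of $\{1,\dots,m\}$, with $c(\pi)$ the number of cycles of $\pi$. For $\mathbf{k}=(k_1,\dots,k_n)\in\mathbb{N}^n$ let $|\mathbf{k}|=\sum_lk_l$ and, for $1\le r\le|\mathbf{k}|$, let $i_r=j$ where $\sum_{l=1}^{j-1}k_l<r\le\sum_{l=1}^jk_l$. For an $n\times n$ matrix $C=(c_{i,j})$, $C(\mathbf{k})$ is the $|\mathbf{k}|\times|\mathbf{k}|$ matrix with $(r,t)$ entry $c_{i_r,i_t}$ (each index $j$ repeated $k_j$ times); for $\mathbf{k}=\mathbf{0}$, $|C(\mathbf{0})|_\alpha=1$. *)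

theory Defs
  imports
    "HOL-Probability.Probability"
    "HOL-Combinatorics.Orbits"
    "Jordan_Normal_Form.Determinant"
begin

text \<open>
  Matrices and vectors are those of \<^theory>\<open>Jordan_Normal_Form.Matrix\<close>, so all indices start at 0;
  the set \<open>\<nat>\<^sup>n\<close> of multi-indices is \<open>carrier_vec n :: nat vec set\<close>.
\<close>

unbundle no vec_syntax

definition nonsingular_M_matrix :: "real mat \<Rightarrow> bool" where
  "nonsingular_M_matrix A \<longleftrightarrow>
     square_mat A \<and>
     (\<forall>i < dim_row A. \<forall>j < dim_row A. i \<noteq> j \<longrightarrow> A $$ (i, j) \<le> 0) \<and>
     (\<exists>A' \<in> carrier_mat (dim_row A) (dim_row A).
        inverts_mat A A' \<and> inverts_mat A' A \<and>
        (\<forall>i < dim_row A. \<forall>j < dim_row A. A' $$ (i, j) \<ge> 0))"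

definition gamma_density :: "real \<Rightarrow> real \<Rightarrow> real \<Rightarrow> real" where
  "gamma_density u v x =
     (if x > 0 then v powr u * x powr (u - 1) * exp (- v * x) / Gamma u else 0)"

text \<open>Fixed points have singleton orbits and hence count as cycles.\<close>

definition num_cycles :: "nat \<Rightarrow> (nat \<Rightarrow> nat) \<Rightarrow> nat" where
  "num_cycles m p = card (orbit p ` {0..<m})"

definition alpha_permanent :: "real \<Rightarrow> real mat \<Rightarrow> real" where
  "alpha_permanent \<alpha> M =
     (\<Sum>p | p permutes {0..<dim_row M}.
        \<alpha> ^ num_cycles (dim_row M) p * (\<Prod>r = 0..<dim_row M. M $$ (r, p r)))"

text \<open>
  With both positions and indices counted from 0, the condition
  \<open>k\<^sub>1 + \<dots> + k\<^sub>j\<^sub>-\<^sub>1 < r \<le> k\<^sub>1 + \<dots> + k\<^sub>j\<close> becomes the half-open one below. It has a unique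
  solution for every \<open>r < \<bar>k\<bar>\<close>, which is the only range in which \<open>block_index\<close> is used.
\<close>

definition block_index :: "nat vec \<Rightarrow> nat \<Rightarrow> nat" where
  "block_index k r =
     (THE j. j < dim_vec k \<and> (\<Sum>l = 0..<j. k $ l) \<le> r \<and> r < (\<Sum>l = 0..j. k $ l))"

definition repeat_mat :: "real mat \<Rightarrow> nat vec \<Rightarrow> real mat" where
  "repeat_mat C k =
     (let m = (\<Sum>l = 0..<dim_vec k. k $ l)
      in mat m m (\<lambda>(r, t). C $$ (block_index k r, block_index k t)))"

end

theory Submission
  imports Defs "Jordan_Normal_Form.Char_Poly"
begin

text \<open>
  Conditioning on \<open>Z\<close> and using the Laplace transform of gamma variables, the claim becomes the
  identity \<open>\<Sum>\<^sub>k \<bar>C(k)\<bar>\<^sub>\<alpha> / k! = det (I - C)\<^sup>-\<^sup>\<alpha>\<close> for the non-negative matrix \<open>C = (D + S)\<^sup>-\<^sup>1 B\<close>.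

  Let \<open>c(t) = \<Sum>\<^sub>k t\<^bsup>|k|\<^esup> \<bar>C(k)\<bar>\<^sub>\<alpha> / k!\<close>, and let \<open>H\<^sub>i\<^sub>j(t)\<close> be the analogous series for permutations with one
  additional distinguished position, whose row is labelled \<open>i\<close> and whose column is labelled \<open>j\<close>.
  Contracting the arrow that leaves the distinguished position gives \<open>(I - t C) H = \<alpha> c C\<close>, and
  \<open>c' = tr H\<close>. By Jacobi's formula \<open>det (I - t C) c' = - \<alpha> det (I - t C)' c\<close> as formal power series.
  Since the Laplace transform is at most 1, the non-negative series \<open>c\<close> converges at \<open>t = 1\<close>.
  Integrating the differential equation then shows that \<open>c(t) det (I - t C)\<^sup>\<alpha> = 1\<close> up to the first zero of
  \<open>det (I - t C)\<close>, so that there is no zero in \<open>[0, 1]\<close>, and \<open>t = 1\<close> gives the identity.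
\<close>

section \<open>Permutations weighted by their number of cycles\<close>

text \<open>Composing with the transposition inserts \<open>b\<close> into the cycle of
  \<open>q\<close> through \<open>a\<close>, immediately after \<open>a\<close>. No cycle is created
  or merged, so deleting \<open>b\<close> carries the orbits bijectively to those of
  \<open>q\<close>.\<close>

lemma card_orbits_contract:
  assumes q: "q permutes U - {b}" and fin: "finite U" and a: "a \<in> U" and b: "b \<in> U" and ab: "a \<noteq> b"
  shows "card (orbit (q \<circ> Transposition.transpose a b) ` U) = card (orbit q ` (U - {b}))"
proof -
  define p where "p = q \<circ> Transposition.transpose a b"
  have p: "p permutes U"
    unfolding p_def
    by (intro permutes_compose permutes_swap_id permutes_subset[OF q]) (use a b in auto)
  have permp: "permutation p" and permq: "permutation q"
    using p q fin by (auto simp: permutation_permutes)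
  have qb: "q b = b" using q by (simp add: permutes_def)
  have pa: "p a = b" using qb by (simp add: p_def)
  have pb: "p b = q a" by (simp add: p_def)
  have pr: "p r = q r" if "r \<noteq> a" "r \<noteq> b" for r using that by (simp add: p_def Transposition.transpose_def)
  have qU: "q r \<in> U - {b}" if "r \<in> U - {b}" for r using permutes_in_image[OF q, of r] that by simp
  have orb: "orbit p r - {b} = orbit q r" if r: "r \<in> U - {b}" for r
  proof
    have "y \<in> orbit p r \<and> y \<noteq> b" if "y \<in> orbit q r" for y
      using that
    proof induction
      case base
      have "r \<in> orbit p r" by (rule permutation_self_in_orbit[OF permp])
      then have "p r \<in> orbit p r" "p (p r) \<in> orbit p r" by (auto intro: orbit.intros)
      then show ?case using r qU[OF r] pa pb pr[of r] by (cases "r = a") auto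
    next
      case (step y)
      then have "p y \<in> orbit p r" "p (p y) \<in> orbit p r" by (auto intro: orbit.intros)
      moreover have "y \<in> U - {b}" using step permutes_orbit_subset[OF p, of r] r by auto
      ultimately show ?case using qU[of y] pa pb pr[of y] by (cases "y = a") auto
    qed
    then show "orbit q r \<subseteq> orbit p r - {b}" by blast
    \<comment> \<open>The claim is adapted at \<open>y = b\<close>, where membership in
      \<open>orbit q r\<close> fails: it suffices to remember \<open>a\<close>, since the next step
      of \<open>p\<close> leads from \<open>b\<close> to \<open>q a\<close>.\<close>
    have "(y \<noteq> b \<longrightarrow> y \<in> orbit q r) \<and> (y = b \<longrightarrow> a \<in> orbit q r)" if "y \<in> orbit p r" for y
      using that
    proof induction
      case base
      have "r \<in> orbit q r" by (rule permutation_self_in_orbit[OF permq])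
      moreover have "q r \<in> orbit q r" by (rule orbit.intros)
      ultimately show ?case using r qU[OF r] pa pr[of r] by (cases "r = a") auto
    next
      case (step y)
      show ?case
      proof (cases "y = b")
        case True
        then have "q a \<in> orbit q r" using step by (auto intro: orbit.intros)
        then show ?thesis using True pb qU[of a] a ab by auto
      next
        case False
        then have y: "y \<in> orbit q r" using step by simp
        then have "q y \<in> orbit q r" by (auto intro: orbit.intros)
        moreover have "y \<in> U - {b}" using y permutes_orbit_subset[OF q r] by auto
        ultimately show ?thesis using y False qU[of y] pa pr[of y] by (cases "y = a") auto
      qed
    qed
    then show "orbit p r - {b} \<subseteq> orbit q r" by blast
  qed
  \<comment> \<open>\<open>b\<close> lies on the cycle of \<open>a\<close>, so it contributes no
    orbit of its own.\<close>
  have "orbit p b = orbit p a" using permutation_orbit_step[OF permp, of a] pa by simp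
  then have img: "orbit p ` U = orbit p ` (U - {b})" using a b ab by (auto simp: image_iff)
  have inj: "inj_on (\<lambda>T. T - {b}) (orbit p ` (U - {b}))"
  proof (rule inj_onI)
    fix T T' assume "T \<in> orbit p ` (U - {b})" "T' \<in> orbit p ` (U - {b})" and "T - {b} = T' - {b}"
    then obtain r r' where T: "T = orbit p r" "T' = orbit p r'"
      and r: "r \<in> U - {b}" and eq: "orbit p r - {b} = orbit p r' - {b}" by blast
    have "r \<in> orbit p r" by (rule permutation_self_in_orbit[OF permp])
    then have "r \<in> orbit p r'" using eq r by blast
    then show "T = T'"
      unfolding T by (meson cyclic_on_orbit' orbit_cyclic_eq3 permp)
  qed
  have "(\<lambda>T. T - {b}) ` (orbit p ` (U - {b})) = orbit q ` (U - {b})"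
    unfolding image_image using orb by (intro image_cong) auto
  then show ?thesis using card_image[OF inj] img by (simp add: p_def)
qed

lemma card_orbits_fixpoint:
  assumes q: "q permutes U - {a}" and fin: "finite U" and a: "a \<in> U"
  shows "card (orbit q ` U) = Suc (card (orbit q ` (U - {a})))"
proof -
  have "q a = a" using q by (simp add: permutes_def)
  then have "orbit q a = {a}" by (simp add: orbit_eq_singleton_iff)
  moreover have "orbit q r \<noteq> {a}" if "r \<in> U - {a}" for r
    using permutes_orbit_subset[OF q that] by auto
  moreover have "U = insert a (U - {a})" using a by auto
  ultimately have "orbit q ` U = insert {a} (orbit q ` (U - {a}))" "{a} \<notin> orbit q ` (U - {a})"
    by (auto simp: image_iff)
  then show ?thesis using fin by simp
qed

text \<open>The image \<open>b\<close> of \<open>a\<close> classifies the permutations: composing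
  \<open>p\<close> with the transposition of \<open>a\<close> and \<open>p a\<close> gives a map
  fixing \<open>p a\<close>, and composing once more recovers \<open>p\<close>.\<close>

lemma sum_permutes_split:
  fixes f :: "('a \<Rightarrow> 'a) \<Rightarrow> 'b :: comm_monoid_add"
  assumes fin: "finite U" and a: "a \<in> U"
  shows "(\<Sum>p | p permutes U. f p) = (\<Sum>b\<in>U. \<Sum>q | q permutes U - {b}. f (q \<circ> Transposition.transpose a b))"
proof -
  have "(\<Sum>b\<in>U. \<Sum>q | q permutes U - {b}. f (q \<circ> Transposition.transpose a b)) =
    (\<Sum>(b, q)\<in>(SIGMA b:U. {q. q permutes U - {b}}). f (q \<circ> Transposition.transpose a b))"
    using fin by (intro sum.Sigma) (auto intro: finite_permutations)
  also have "\<dots> = (\<Sum>p | p permutes U. f p)"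
  proof (rule sum.reindex_bij_witness[where i = "\<lambda>p. (p a, p \<circ> Transposition.transpose a (p a))"
        and j = "\<lambda>(b, q). q \<circ> Transposition.transpose a b"]; clarsimp)
    fix b q assume b: "b \<in> U" and q: "q permutes U - {b}"
    have qb: "q b = b" using q by (simp add: permutes_def)
    then show "q b = b \<and> q \<circ> Transposition.transpose a b \<circ> Transposition.transpose a (q b) = q"
      by (simp add: comp_assoc)
    show "q \<circ> Transposition.transpose a b permutes U"
      by (intro permutes_compose permutes_swap_id permutes_subset[OF q]) (use a b in auto)
  next
    fix p assume p: "p permutes U"
    show pa: "p a \<in> U \<and> p \<circ> Transposition.transpose a (p a) permutes U - {p a}"
    proof
      show pa: "p a \<in> U" using p a by (simp add: permutes_in_image)
      have "p \<circ> Transposition.transpose a (p a) permutes U"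
        by (intro permutes_compose permutes_swap_id p a pa)
      then show "p \<circ> Transposition.transpose a (p a) permutes U - {p a}"
        by (rule permutes_superset) auto
    qed
    show "p \<circ> Transposition.transpose a (p a) \<circ> Transposition.transpose a (p a) = p" by (simp add: comp_assoc)
  qed
  finally show ?thesis by simp
qed

text \<open>Rows and columns are labelled separately, because contracting an arrow \<open>a \<rightarrow> b\<close> of a
  permutation leaves a position with the row of one index and the column of another.\<close>

definition perm_sum ::
    "'c \<Rightarrow> ('l \<Rightarrow> 'l \<Rightarrow> 'c) \<Rightarrow> 'a set \<Rightarrow> ('a \<Rightarrow> 'l) \<Rightarrow> ('a \<Rightarrow> 'l) \<Rightarrow> 'c :: comm_semiring_1" where
  "perm_sum \<alpha> C U u v =
     (\<Sum>p | p permutes U. \<alpha> ^ card (orbit p ` U) * (\<Prod>r\<in>U. C (u r) (v (p r))))"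

lemma perm_sum_empty [simp]: "perm_sum \<alpha> C {} u v = 1"
  by (simp add: perm_sum_def)

lemma perm_sum_cong:
  assumes "\<And>r. r \<in> U \<Longrightarrow> u r = u' r" "\<And>r. r \<in> U \<Longrightarrow> v r = v' r"
  shows "perm_sum \<alpha> C U u v = perm_sum \<alpha> C U u' v'"
  unfolding perm_sum_def
  by (intro sum.cong refl arg_cong2[where f = "(*)"] prod.cong) (auto simp: assms permutes_in_image)

text \<open>Expansion by the arrow leaving \<open>a\<close>. A loop is a cycle of its own and costs
  a factor \<alpha>. An arrow to another position \<open>b\<close> is contracted without changing
  the number of cycles; the merged position keeps the name and column label of \<open>a\<close> and
  takes over the row label of \<open>b\<close>.\<close>

lemma perm_sum_rec:
  assumes fin: "finite U" and a: "a \<in> U"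
  shows "perm_sum \<alpha> C U u v = \<alpha> * C (u a) (v a) * perm_sum \<alpha> C (U - {a}) u v +
    (\<Sum>b\<in>U - {a}. C (u a) (v b) * perm_sum \<alpha> C (U - {b}) (u(a := u b)) v)"
proof -
  let ?f = "\<lambda>p. \<alpha> ^ card (orbit p ` U) * (\<Prod>r\<in>U. C (u r) (v (p r)))"
  have fixed: "?f (q \<circ> Transposition.transpose a a) = \<alpha> * C (u a) (v a) *
      (\<alpha> ^ card (orbit q ` (U - {a})) * (\<Prod>r\<in>U - {a}. C (u r) (v (q r))))"
    if q: "q permutes U - {a}" for q
  proof -
    have "q a = a" using q by (simp add: permutes_def)
    then show ?thesis
      using prod.remove[OF fin a, of "\<lambda>r. C (u r) (v (q r))"]
      by (simp add: card_orbits_fixpoint[OF q fin a] mult_ac)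
  qed
  have contract: "?f (q \<circ> Transposition.transpose a b) = C (u a) (v b) *
      (\<alpha> ^ card (orbit q ` (U - {b})) * (\<Prod>r\<in>U - {b}. C ((u(a := u b)) r) (v (q r))))"
    if b: "b \<in> U - {a}" and q: "q permutes U - {b}" for b q
  proof -
    have qb: "q b = b" using q by (simp add: permutes_def)
    have "(\<Prod>r\<in>U. C (u r) (v ((q \<circ> Transposition.transpose a b) r))) =
      C (u a) (v b) * (C (u b) (v (q a)) * (\<Prod>r\<in>U - {a} - {b}. C (u r) (v ((q \<circ> Transposition.transpose a b) r))))"
      using fin b by (subst prod.remove[OF fin a], subst prod.remove[of "U - {a}" b]) (auto simp: qb)
    also have "(\<Prod>r\<in>U - {a} - {b}. C (u r) (v ((q \<circ> Transposition.transpose a b) r))) =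
        (\<Prod>r\<in>U - {b} - {a}. C ((u(a := u b)) r) (v (q r)))"
      by (intro prod.cong) (auto simp: Transposition.transpose_def)
    also have "C (u b) (v (q a)) * \<dots> = (\<Prod>r\<in>U - {b}. C ((u(a := u b)) r) (v (q r)))"
      using prod.remove[of "U - {b}" a "\<lambda>r. C ((u(a := u b)) r) (v (q r))"] fin a b
      by force
    finally have "(\<Prod>r\<in>U. C (u r) (v ((q \<circ> Transposition.transpose a b) r))) =
      C (u a) (v b) * (\<Prod>r\<in>U - {b}. C ((u(a := u b)) r) (v (q r)))" .
    moreover have "card (orbit (q \<circ> Transposition.transpose a b) ` U) = card (orbit q ` (U - {b}))"
      by (rule card_orbits_contract[OF q fin a]) (use b in auto)
    ultimately show ?thesis by (simp only: mult_ac)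
  qed
  have "perm_sum \<alpha> C U u v = (\<Sum>b\<in>U. \<Sum>q | q permutes U - {b}. ?f (q \<circ> Transposition.transpose a b))"
    unfolding perm_sum_def by (rule sum_permutes_split[OF fin a])
  also have "\<dots> = (\<Sum>q | q permutes U - {a}. ?f (q \<circ> Transposition.transpose a a)) +
      (\<Sum>b\<in>U - {a}. \<Sum>q | q permutes U - {b}. ?f (q \<circ> Transposition.transpose a b))"
    by (rule sum.remove[OF fin a])
  also have "(\<Sum>q | q permutes U - {a}. ?f (q \<circ> Transposition.transpose a a)) =
      \<alpha> * C (u a) (v a) * perm_sum \<alpha> C (U - {a}) u v"
    unfolding perm_sum_def sum_distrib_left by (intro sum.cong refl fixed) auto
  also have "(\<Sum>b\<in>U - {a}. \<Sum>q | q permutes U - {b}. ?f (q \<circ> Transposition.transpose a b)) =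
      (\<Sum>b\<in>U - {a}. C (u a) (v b) * perm_sum \<alpha> C (U - {b}) (u(a := u b)) v)"
    unfolding perm_sum_def sum_distrib_left by (intro sum.cong refl contract) auto
  finally show ?thesis .
qed

text \<open>The values of the permutation sums above, as functions of the multiset of labels: of all labels,
  respectively of the labels outside the distinguished position, which has row \<open>i\<close> and column \<open>j\<close>.
  Any single \<open>x \<in># K\<close> would do in the second equation; averaging over all of them avoids a choice.\<close>

function mset_perm_sum :: "real \<Rightarrow> ('l \<Rightarrow> 'l \<Rightarrow> real) \<Rightarrow> nat \<Rightarrow> 'l multiset \<Rightarrow> real"
  and mset_path_sum :: "real \<Rightarrow> ('l \<Rightarrow> 'l \<Rightarrow> real) \<Rightarrow> nat \<Rightarrow> 'l multiset \<Rightarrow> 'l \<Rightarrow> 'l \<Rightarrow> real" where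
  "mset_perm_sum \<alpha> C 0 K = 1"
| "mset_perm_sum \<alpha> C (Suc m) K = (\<Sum>x\<in>#K. mset_path_sum \<alpha> C m (K - {#x#}) x x) / real (Suc m)"
| "mset_path_sum \<alpha> C 0 K i j = \<alpha> * C i j"
| "mset_path_sum \<alpha> C (Suc m) K i j =
     \<alpha> * C i j * mset_perm_sum \<alpha> C (Suc m) K + (\<Sum>x\<in>#K. C i x * mset_path_sum \<alpha> C m (K - {#x#}) x j)"
  by pat_completeness auto
termination
  by (relation "Wellfounded.measure (case_sum (\<lambda>(_, _, m, _). 2 * m) (\<lambda>(_, _, m, _, _, _). 2 * m + 1))") auto

text \<open>The expansion \<open>perm_sum_rec\<close> mirrors the equations of
  \<open>mset_path_sum\<close>, so positions matter only through their labels. The claims are proved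
  jointly: a cyclic sum over \<open>Suc m\<close> positions reduces to path sums of index
  \<open>m\<close>, and a path sum of index \<open>Suc m\<close> uses that cyclic sum.\<close>

lemma perm_sum_content:
  fixes C :: "'l \<Rightarrow> 'l \<Rightarrow> real"
  shows "finite U \<Longrightarrow> card U = m \<Longrightarrow> image_mset v (mset_set U) = K \<Longrightarrow>
      perm_sum \<alpha> C U v v = mset_perm_sum \<alpha> C m K"
    and "finite U \<Longrightarrow> a \<in> U \<Longrightarrow> card U = Suc m \<Longrightarrow> (\<And>r. r \<in> U - {a} \<Longrightarrow> u r = v r) \<Longrightarrow>
      image_mset v (mset_set (U - {a})) = K \<Longrightarrow>
      perm_sum \<alpha> C U u v = mset_path_sum \<alpha> C m K (u a) (v a)"
proof (induction m arbitrary: U u a K)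
  case 0
  {
    case 1
    then show ?case by simp
  next
    case 2
    then have "U = {a}" by (metis card_1_singletonE One_nat_def singletonD)
    then show ?case by (simp add: perm_sum_rec[of "{a}" a])
  }
next
  case (Suc m)
  have cyc: "perm_sum \<alpha> C U v v = mset_perm_sum \<alpha> C (Suc m) (image_mset v (mset_set U))"
    if U: "finite U" "card U = Suc m" for U
  proof -
    let ?K = "image_mset v (mset_set U)"
    \<comment> \<open>Any position may be declared distinguished, its row and column then carrying
      the same label. Adding over all \<open>a\<close> gives \<open>card U\<close> copies of one
      number, which is the average in \<open>mset_perm_sum\<close>.\<close>
    have "perm_sum \<alpha> C U v v = mset_path_sum \<alpha> C m (?K - {#v a#}) (v a) (v a)" if a: "a \<in> U" for a
      by (intro Suc.IH(2)) (use U a in \<open>auto simp: mset_set_Diff image_mset_Diff\<close>)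
    then have "real (card U) * perm_sum \<alpha> C U v v =
        (\<Sum>a\<in>U. mset_path_sum \<alpha> C m (?K - {#v a#}) (v a) (v a))"
      by (metis (no_types, lifting) sum.cong sum_constant)
    also have "\<dots> = (\<Sum>x\<in>#?K. mset_path_sum \<alpha> C m (?K - {#x#}) x x)"
      by (simp add: sum_unfold_sum_mset image_mset.compositionality comp_def)
    finally show ?thesis using U by (simp add: field_simps)
  qed
  {
    case 1
    then show ?case using cyc by auto
  next
    case 2
    note U = 2(1-3) and uv = 2(4)
    have K: "K = image_mset v (mset_set (U - {a}))" using 2(5) by simp
    have "perm_sum \<alpha> C (U - {a}) u v = perm_sum \<alpha> C (U - {a}) v v"
      by (rule perm_sum_cong) (use uv in auto)
    also have "\<dots> = mset_perm_sum \<alpha> C (Suc m) K"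
      unfolding K by (rule cyc) (use U in auto)
    finally have fixed: "perm_sum \<alpha> C (U - {a}) u v = mset_perm_sum \<alpha> C (Suc m) K" .
    have contract: "perm_sum \<alpha> C (U - {b}) (u(a := u b)) v = mset_path_sum \<alpha> C m (K - {#v b#}) (v b) (v a)"
      if b: "b \<in> U - {a}" for b
    proof -
      have "U - {b} - {a} = U - {a} - {b}" by auto
      moreover have "mset_set (U - {a} - {b}) = mset_set (U - {a}) - {#b#}"
        by (subst mset_set_Diff) (use U b in auto)
      ultimately have "image_mset v (mset_set (U - {b} - {a})) = K - {#v b#}"
        unfolding K using U b by (simp add: image_mset_Diff)
      then have "perm_sum \<alpha> C (U - {b}) (u(a := u b)) v =
          mset_path_sum \<alpha> C m (K - {#v b#}) ((u(a := u b)) a) (v a)"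
        by (intro Suc.IH(2)) (use U b uv in auto)
      then show ?thesis using uv[OF b] by simp
    qed
    have "(\<Sum>b\<in>U - {a}. C (u a) (v b) * perm_sum \<alpha> C (U - {b}) (u(a := u b)) v) =
        (\<Sum>b\<in>U - {a}. C (u a) (v b) * mset_path_sum \<alpha> C m (K - {#v b#}) (v b) (v a))"
      using contract by (intro sum.cong) auto
    also have "\<dots> = (\<Sum>x\<in>#K. C (u a) x * mset_path_sum \<alpha> C m (K - {#x#}) x (v a))"
      by (simp add: K sum_unfold_sum_mset image_mset.compositionality comp_def)
    finally show ?case
      using perm_sum_rec[OF U(1,2), of \<alpha> C u v] fixed by simp
  }
qed

section \<open>Coefficients of the exponential generating functions, with multisets as
  multi-indices\<close>

definition mset_fact :: "nat \<Rightarrow> nat multiset \<Rightarrow> real" where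
  "mset_fact n K = (\<Prod>i<n. fact (count K i))"

lemma mset_fact_pos: "mset_fact n K > 0"
  by (simp add: mset_fact_def prod_pos)

lemma mset_fact_add:
  assumes "x < n"
  shows "mset_fact n (add_mset x K) = real (Suc (count K x)) * mset_fact n K"
proof -
  have "mset_fact n (add_mset x K) = fact (Suc (count K x)) * (\<Prod>i\<in>{..<n} - {x}. fact (count K i))"
    unfolding mset_fact_def by (subst prod.remove[of _ x]) (use assms in auto)
  moreover have "mset_fact n K = fact (count K x) * (\<Prod>i\<in>{..<n} - {x}. fact (count K i))"
    unfolding mset_fact_def by (subst prod.remove[of _ x]) (use assms in auto)
  ultimately show ?thesis by simp
qed

lemma sum_mset_conv_count:
  fixes f :: "'a \<Rightarrow> real"
  shows "(\<Sum>x\<in>#K. f x) = (\<Sum>x\<in>set_mset K. real (count K x) * f x)"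
proof (induction K)
  case (add y K)
  have "(\<Sum>x\<in>insert y (set_mset K). real (count (add_mset y K) x) * f x) =
      (\<Sum>x\<in>insert y (set_mset K). real (count K x) * f x + (if x = y then f y else 0))"
    by (intro sum.cong) (auto simp: algebra_simps)
  also have "\<dots> = (\<Sum>x\<in>insert y (set_mset K). real (count K x) * f x) + f y"
    by (simp add: sum.distrib)
  also have "(\<Sum>x\<in>insert y (set_mset K). real (count K x) * f x) =
      (\<Sum>x\<in>set_mset K. real (count K x) * f x)"
    by (rule sum.mono_neutral_right) (auto simp: not_in_iff)
  finally show ?case using add by simp
qed simp

text \<open>Pairs \<open>(K, x)\<close> are reindexed as \<open>(K - {#x#}, x)\<close>. The
  multiplicity with which \<open>x\<close> is drawn from \<open>K\<close> is exactly the ratio of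
  the two multi-index factorials.\<close>

lemma sum_multisets_of_size_Suc:
  fixes f :: "nat multiset \<Rightarrow> nat \<Rightarrow> real"
  shows "(\<Sum>K\<in>multisets_of_size {..<n} (Suc m). (\<Sum>x\<in>#K. f (K - {#x#}) x) / mset_fact n K) =
    (\<Sum>K\<in>multisets_of_size {..<n} m. (\<Sum>x<n. f K x) / mset_fact n K)"
proof -
  have "(\<Sum>K\<in>multisets_of_size {..<n} (Suc m). (\<Sum>x\<in>#K. f (K - {#x#}) x) / mset_fact n K) =
      (\<Sum>K\<in>multisets_of_size {..<n} (Suc m). \<Sum>x\<in>set_mset K. real (count K x) * f (K - {#x#}) x / mset_fact n K)"
    by (simp add: sum_mset_conv_count sum_divide_distrib)
  also have "\<dots> = (\<Sum>(K, x)\<in>(SIGMA K:multisets_of_size {..<n} (Suc m). set_mset K).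
      real (count K x) * f (K - {#x#}) x / mset_fact n K)"
    by (intro sum.Sigma) auto
  also have "\<dots> = (\<Sum>(K, x)\<in>multisets_of_size {..<n} m \<times> {..<n}. f K x / mset_fact n K)"
  proof (rule sum.reindex_bij_witness[where i = "\<lambda>(K, x). (add_mset x K, x)"
        and j = "\<lambda>(K, x). (K - {#x#}, x)"]; clarsimp)
    fix K x assume K: "K \<in> multisets_of_size {..<n} (Suc m)" "x \<in># K"
    then obtain L where L: "K = add_mset x L" by (metis insert_DiffM)
    have x: "x < n" using K by (auto simp: multisets_of_size_def)
    show "K - {#x#} \<in> multisets_of_size {..<n} m \<and> x < n"
      using K x by (auto simp: L multisets_of_size_def)
    show "f (K - {#x#}) x / mset_fact n (K - {#x#}) = real (count K x) * f (K - {#x#}) x / mset_fact n K"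
      using mset_fact_add[OF x, of L] mset_fact_pos[of n L] by (simp add: L del: of_nat_Suc)
  qed (auto simp: multisets_of_size_def)
  also have "\<dots> = (\<Sum>K\<in>multisets_of_size {..<n} m. \<Sum>x<n. f K x / mset_fact n K)"
    by (simp add: sum.cartesian_product)
  finally show ?thesis by (simp add: sum_divide_distrib)
qed

definition perm_coeff :: "real \<Rightarrow> (nat \<Rightarrow> nat \<Rightarrow> real) \<Rightarrow> nat \<Rightarrow> nat \<Rightarrow> real" where
  "perm_coeff \<alpha> C n m = (\<Sum>K\<in>multisets_of_size {..<n} m. mset_perm_sum \<alpha> C m K / mset_fact n K)"

text \<open>The coefficient of \<open>t^m\<close> in \<open>H\<^sub>i\<^sub>j(t)\<close>. The
  exponent counts the ordinary positions only, although \<open>m + 1\<close> positions are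
  permuted.\<close>

definition path_coeff :: "real \<Rightarrow> (nat \<Rightarrow> nat \<Rightarrow> real) \<Rightarrow> nat \<Rightarrow> nat \<Rightarrow> nat \<Rightarrow> nat \<Rightarrow> real" where
  "path_coeff \<alpha> C n m i j = (\<Sum>K\<in>multisets_of_size {..<n} m. mset_path_sum \<alpha> C m K i j / mset_fact n K)"

lemma perm_coeff_0 [simp]: "perm_coeff \<alpha> C n 0 = 1"
  by (simp add: perm_coeff_def mset_fact_def)

text \<open>This is \<open>c' = tr H\<close> on coefficients; the factor \<open>Suc m\<close>
  cancels the averaging over distinguished positions.\<close>

lemma perm_coeff_Suc: "real (Suc m) * perm_coeff \<alpha> C n (Suc m) = (\<Sum>i<n. path_coeff \<alpha> C n m i i)"
proof -
  have cancel: "real (Suc m) * (y / real (Suc m) / z) = y / z" for y z :: real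
    by (simp del: of_nat_Suc)
  have "real (Suc m) * perm_coeff \<alpha> C n (Suc m) =
      (\<Sum>K\<in>multisets_of_size {..<n} (Suc m). (\<Sum>x\<in>#K. mset_path_sum \<alpha> C m (K - {#x#}) x x) / mset_fact n K)"
    unfolding perm_coeff_def sum_distrib_left by (simp only: mset_perm_sum.simps cancel)
  also have "\<dots> = (\<Sum>K\<in>multisets_of_size {..<n} m. (\<Sum>x<n. mset_path_sum \<alpha> C m K x x) / mset_fact n K)"
    by (rule sum_multisets_of_size_Suc)
  also have "\<dots> = (\<Sum>i<n. path_coeff \<alpha> C n m i i)"
    unfolding path_coeff_def sum_divide_distrib by (rule sum.swap)
  finally show ?thesis .
qed

lemma path_coeff_0: "path_coeff \<alpha> C n 0 i j = \<alpha> * C i j"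
  by (simp add: path_coeff_def mset_fact_def)

text \<open>This is \<open>H = \<alpha> c C + t C H\<close> on coefficients: the arrow from the
  distinguished position either returns to it or enters an ordinary position, which is then
  absorbed.\<close>

lemma path_coeff_Suc:
  "path_coeff \<alpha> C n (Suc m) i j =
     \<alpha> * C i j * perm_coeff \<alpha> C n (Suc m) + (\<Sum>l<n. C i l * path_coeff \<alpha> C n m l j)"
proof -
  have "path_coeff \<alpha> C n (Suc m) i j = \<alpha> * C i j * perm_coeff \<alpha> C n (Suc m) +
      (\<Sum>K\<in>multisets_of_size {..<n} (Suc m). (\<Sum>x\<in>#K. C i x * mset_path_sum \<alpha> C m (K - {#x#}) x j) / mset_fact n K)"
    unfolding path_coeff_def perm_coeff_def sum_distrib_left sum.distrib[symmetric]
    by (intro sum.cong) (auto simp del: mset_perm_sum.simps simp add: add_divide_distrib)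
  also have "(\<Sum>K\<in>multisets_of_size {..<n} (Suc m). (\<Sum>x\<in>#K. C i x * mset_path_sum \<alpha> C m (K - {#x#}) x j) / mset_fact n K) =
      (\<Sum>K\<in>multisets_of_size {..<n} m. (\<Sum>x<n. C i x * mset_path_sum \<alpha> C m K x j) / mset_fact n K)"
    by (rule sum_multisets_of_size_Suc)
  also have "\<dots> = (\<Sum>x<n. \<Sum>K\<in>multisets_of_size {..<n} m. C i x * mset_path_sum \<alpha> C m K x j / mset_fact n K)"
    unfolding sum_divide_distrib by (rule sum.swap)
  finally show ?thesis
    by (simp add: path_coeff_def sum_distrib_left)
qed

section \<open>The differential equation of the generating function\<close>

text \<open>Jacobi's formula. The product rule in the Leibniz expansion differentiates one row at a
  time. Laplace expansion along that row yields the cofactors of \<open>N\<close> itself, because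
  the only altered row is deleted.\<close>

lemma pderiv_det:
  fixes N :: "'a :: idom poly mat"
  assumes N: "N \<in> carrier_mat n n"
  shows "pderiv (det N) = (\<Sum>i<n. \<Sum>j<n. pderiv (N $$ (i, j)) * cofactor N i j)"
proof -
  define R where "R i = mat n n (\<lambda>(r, c). if r = i then pderiv (N $$ (r, c)) else N $$ (r, c))" for i
  have R: "R i \<in> carrier_mat n n" for i by (simp add: R_def)
  have "pderiv (det N) =
      (\<Sum>p | p permutes {0..<n}. signof p * pderiv (\<Prod>i = 0..<n. N $$ (i, p i)))"
  proof -
    have "pderiv (signof p * f) = signof p * pderiv f" for p :: "nat \<Rightarrow> nat" and f :: "'a poly"
      by (cases p rule: sign_cases) (simp_all add: pderiv_minus)
    then show ?thesis by (simp add: det_def'[OF N] pderiv_sum)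
  qed
  also have "\<dots> = (\<Sum>p | p permutes {0..<n}. \<Sum>i<n. signof p * (\<Prod>r = 0..<n. R i $$ (r, p r)))"
  proof (intro sum.cong refl)
    fix p assume "p \<in> {p. p permutes {0..<n}}"
    then have p: "p permutes {0..<n}" by simp
    have pn: "p r < n" if "r < n" for r using permutes_in_image[OF p, of r] that by simp
    have "(\<Prod>r = 0..<n. R i $$ (r, p r)) =
        pderiv (N $$ (i, p i)) * (\<Prod>r\<in>{0..<n} - {i}. N $$ (r, p r))" if "i < n" for i
      by (subst prod.remove[of _ i]) (use that pn in \<open>auto simp: R_def intro!: prod.cong\<close>)
    then show "signof p * pderiv (\<Prod>i = 0..<n. N $$ (i, p i)) =
        (\<Sum>i<n. signof p * (\<Prod>r = 0..<n. R i $$ (r, p r)))"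
      by (simp add: pderiv_prod sum_distrib_left atLeast0LessThan mult_ac)
  qed
  also have "\<dots> = (\<Sum>i<n. det (R i))"
    by (subst sum.swap) (simp add: det_def'[OF R])
  also have "\<dots> = (\<Sum>i<n. \<Sum>j<n. pderiv (N $$ (i, j)) * cofactor N i j)"
  proof (intro sum.cong refl)
    fix i assume "i \<in> {..<n}"
    then have i: "i < n" by simp
    have "mat_delete (R i) i j = mat_delete N i j" if "j < n" for j
      using i N that by (intro eq_matI) (auto simp: mat_delete_def R_def)
    then show "det (R i) = (\<Sum>j<n. pderiv (N $$ (i, j)) * cofactor N i j)"
      unfolding laplace_expansion_row[OF R i] cofactor_def
      by (intro sum.cong refl) (use i in \<open>auto simp: R_def\<close>)
  qed
  finally show ?thesis .
qed

text \<open>Multiplying by the adjugate solves the linear system for \<open>H\<close> without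
  division.\<close>

lemma adj_mat_sum:
  fixes N :: "'a :: comm_ring_1 mat"
  assumes N: "N \<in> carrier_mat n n" and k: "k < n" "l < n"
  shows "(\<Sum>i<n. cofactor N i k * N $$ (i, l)) = (if k = l then det N else 0)"
proof -
  have "(adj_mat N * N) $$ (k, l) = (\<Sum>i<n. cofactor N i k * N $$ (i, l))"
    using N k by (simp add: adj_mat_def scalar_prod_def atLeast0LessThan)
  then show ?thesis using adj_mat(3)[OF N] k by (cases "k = l") simp_all
qed

text \<open>The series \<open>E i j\<close> are the entries of \<open>H\<close>. Multiplying
  \<open>N E = \<alpha> c C\<close> by the adjugate gives
  \<open>det N E = \<alpha> c adj(N) C\<close>. On taking the trace, \<open>C = - N'\<close> and
  Jacobi's formula produce the derivative of \<open>det N\<close>.\<close>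

lemma perm_coeff_fps_deriv:
  fixes C :: "nat \<Rightarrow> nat \<Rightarrow> real" and \<alpha> :: real and n :: nat
  defines "N \<equiv> mat n n (\<lambda>(i, j). (if i = j then 1 else 0) - [:0, C i j:])"
    and "c \<equiv> Abs_fps (perm_coeff \<alpha> C n)"
  shows "fps_of_poly (det N) * fps_deriv c = - (fps_const \<alpha> * fps_of_poly (pderiv (det N)) * c)"
proof -
  define E where "E i j = Abs_fps (\<lambda>m. path_coeff \<alpha> C n m i j)" for i j
  have N: "N \<in> carrier_mat n n" by (simp add: N_def)
  have E: "E i j = fps_const (\<alpha> * C i j) * c + fps_X * (\<Sum>l<n. fps_const (C i l) * E l j)" for i j
  proof (rule fps_ext)
    fix m show "fps_nth (E i j) m =
        fps_nth (fps_const (\<alpha> * C i j) * c + fps_X * (\<Sum>l<n. fps_const (C i l) * E l j)) m"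
      by (cases m) (simp_all add: E_def c_def path_coeff_0 path_coeff_Suc fps_sum_nth)
  qed
  have NE: "(\<Sum>l<n. fps_of_poly (N $$ (i, l)) * E l j) = fps_const (\<alpha> * C i j) * c" if i: "i < n" for i j
  proof -
    have entry: "fps_of_poly (N $$ (i, l)) * E l j =
        (if l = i then E i j else 0) - fps_X * (fps_const (C i l) * E l j)" if "l < n" for l
    proof -
      have "fps_of_poly [:0, C i l:] = fps_X * fps_const (C i l)"
        by (simp add: fps_of_poly_pCons)
      then show ?thesis using i that by (simp add: N_def fps_of_poly_diff algebra_simps)
    qed
    have "(\<Sum>l<n. fps_of_poly (N $$ (i, l)) * E l j) =
        E i j - fps_X * (\<Sum>l<n. fps_const (C i l) * E l j)"
      using i by (simp add: entry sum_subtractf sum_distrib_left)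
    also have "\<dots> = fps_const (\<alpha> * C i j) * c" by (subst E) simp
    finally show ?thesis .
  qed
  have detE: "fps_of_poly (det N) * E k j = (\<Sum>i<n. fps_of_poly (cofactor N i k) * (fps_const (\<alpha> * C i j) * c))"
    if k: "k < n" for k j
  proof -
    have "(\<Sum>i<n. fps_of_poly (cofactor N i k) * (fps_const (\<alpha> * C i j) * c)) =
        (\<Sum>i<n. \<Sum>l<n. fps_of_poly (cofactor N i k) * (fps_of_poly (N $$ (i, l)) * E l j))"
      by (intro sum.cong refl) (simp add: NE[symmetric] sum_distrib_left)
    also have "\<dots> = (\<Sum>l<n. fps_of_poly (\<Sum>i<n. cofactor N i k * N $$ (i, l)) * E l j)"
      by (subst sum.swap) (simp add: fps_of_poly_sum fps_of_poly_mult sum_distrib_right mult.assoc)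
    also have "\<dots> = (\<Sum>l<n. if l = k then fps_of_poly (det N) * E k j else 0)"
      by (intro sum.cong refl) (use k in \<open>auto simp: adj_mat_sum[OF N]\<close>)
    also have "\<dots> = fps_of_poly (det N) * E k j" using k by simp
    finally show ?thesis by simp
  qed
  have deriv: "fps_deriv c = (\<Sum>k<n. E k k)"
    by (rule fps_ext) (simp add: c_def E_def fps_sum_nth perm_coeff_Suc[symmetric])
  have "fps_of_poly (det N) * fps_deriv c =
      (\<Sum>k<n. \<Sum>i<n. fps_of_poly (cofactor N i k) * (fps_const (\<alpha> * C i k) * c))"
    unfolding deriv sum_distrib_left by (intro sum.cong refl detE) simp
  also have "\<dots> = (\<Sum>i<n. \<Sum>k<n. fps_of_poly (cofactor N i k) * (fps_const (\<alpha> * C i k) * c))"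
    by (rule sum.swap)
  also have "\<dots> = (\<Sum>i<n. \<Sum>k<n. - (fps_const \<alpha> * fps_of_poly (pderiv (N $$ (i, k)) * cofactor N i k) * c))"
  proof (intro sum.cong refl)
    fix i k assume "i \<in> {..<n}" "k \<in> {..<n}"
    then have "pderiv (N $$ (i, k)) = - [:C i k:]"
      by (auto simp: N_def pderiv_diff pderiv_pCons)
    then show "fps_of_poly (cofactor N i k) * (fps_const (\<alpha> * C i k) * c) =
        - (fps_const \<alpha> * fps_of_poly (pderiv (N $$ (i, k)) * cofactor N i k) * c)"
      by (simp add: fps_of_poly_mult fps_of_poly_uminus fps_of_poly_const fps_const_mult[symmetric] mult_ac
          del: fps_const_mult minus_pCons mult_pCons_left)
  qed
  also have "\<dots> = - (fps_const \<alpha> * fps_of_poly (pderiv (det N)) * c)"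
    by (simp add: pderiv_det[OF N] fps_of_poly_sum sum_distrib_left sum_distrib_right sum_negf)
  finally show ?thesis .
qed

section \<open>Solving the differential equation up to the endpoint of the unit interval\<close>

lemma suminf_eq_powr_of_ode:
  fixes c :: "nat \<Rightarrow> real" and p :: "real poly"
  assumes nonneg: "\<And>m. c m \<ge> 0" and c0: "c 0 = 1" and summ: "summable c"
    and p0: "poly p 0 = 1" and \<alpha>: "\<alpha> > 0"
    and ode: "fps_of_poly p * fps_deriv (Abs_fps c) = - (fps_const \<alpha> * fps_of_poly (pderiv p) * Abs_fps c)"
  shows "poly p 1 > 0" and "suminf c = poly p 1 powr (- \<alpha>)"
proof -
  define h where "h = eval_fps (Abs_fps c)"
  \<comment> \<open>A first integral of \<open>p h' = - \<alpha> p' h\<close>: its derivative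
    vanishes at interior points where \<open>p\<close> is positive.\<close>
  define \<phi> where "\<phi> t = h t * poly p t powr \<alpha>" for t
  have radius: "fps_conv_radius (Abs_fps c) \<ge> 1"
    using conv_radius_geI[of c "1 :: real"] summ by (simp add: fps_conv_radius_def one_ereal_def)
  \<comment> \<open>The bound on the radius settles only \<open>t < 1\<close>. At the endpoint,
    continuity comes from uniform convergence with the summable majorant \<open>c\<close>.\<close>
  have h_cont: "continuous_on {0..1} h"
  proof (rule uniform_limit_theorem)
    show "uniform_limit {0..1} (\<lambda>m t. \<Sum>i<m. c i * t ^ i) h sequentially"
      unfolding h_def eval_fps_def fps_nth_Abs_fps
      by (rule Weierstrass_m_test[OF _ summ])
        (auto simp: abs_mult nonneg power_le_one intro!: mult_left_le)
    show "\<forall>\<^sub>F m in sequentially. continuous_on {0..1} (\<lambda>t. \<Sum>i<m. c i * t ^ i)"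
      by (intro always_eventually allI continuous_intros)
  qed simp
  have h_deriv: "(h has_real_derivative eval_fps (fps_deriv (Abs_fps c)) t) (at t)"
    and h_ode: "poly p t * eval_fps (fps_deriv (Abs_fps c)) t = - \<alpha> * poly (pderiv p) t * h t"
    if t: "0 < t" "t < 1" for t
  proof -
    have in_disc: "ereal (norm t) < fps_conv_radius (Abs_fps c)"
      using t radius by (intro less_le_trans[OF _ radius]) (auto simp: one_ereal_def)
    then show "(h has_real_derivative eval_fps (fps_deriv (Abs_fps c)) t) (at t)"
      unfolding h_def by (rule has_field_derivative_eval_fps)
    have "ereal (norm t) < fps_conv_radius (fps_deriv (Abs_fps c))"
      using in_disc fps_conv_radius_deriv[of "Abs_fps c"] by (rule less_le_trans)
    then have "poly p t * eval_fps (fps_deriv (Abs_fps c)) t = eval_fps (fps_of_poly p * fps_deriv (Abs_fps c)) t"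
      by (simp add: eval_fps_mult)
    also have "\<dots> = eval_fps (fps_of_poly (Polynomial.smult (- \<alpha>) (pderiv p)) * Abs_fps c) t"
      by (simp add: ode fps_of_poly_smult fps_of_poly_uminus)
    also have "\<dots> = - \<alpha> * poly (pderiv p) t * h t"
      using in_disc unfolding h_def by (subst eval_fps_mult) auto
    finally show "poly p t * eval_fps (fps_deriv (Abs_fps c)) t = - \<alpha> * poly (pderiv p) t * h t" .
  qed
  \<comment> \<open>\<open>p\<close> may vanish at \<open>t0\<close> itself, since
    \<open>powr\<close> with positive exponent is continuous at base 0. This serves both a
    hypothetical first zero and the endpoint \<open>t = 1\<close>.\<close>
  have \<phi>_eq: "\<phi> t0 = 1" if t0: "0 < t0" "t0 \<le> 1" and pos: "\<And>t. 0 \<le> t \<Longrightarrow> t < t0 \<Longrightarrow> poly p t > 0"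
    and end_nonneg: "poly p t0 \<ge> 0" for t0
  proof -
    have "\<phi> t0 = \<phi> 0"
    proof (rule DERIV_isconst_end[OF t0(1)])
      have "poly p t \<ge> 0" if "t \<in> {0..t0}" for t
        using pos[of t] end_nonneg that by (cases "t = t0") auto
      then show "continuous_on {0..t0} \<phi>"
        unfolding \<phi>_def using t0 \<alpha>
        by (intro continuous_on_mult continuous_on_powr' continuous_on_subset[OF h_cont] continuous_intros) auto
      fix t assume t: "0 < t" "t < t0"
      then have p: "poly p t > 0" by (intro pos) auto
      have "(\<phi> has_real_derivative (eval_fps (fps_deriv (Abs_fps c)) t * poly p t powr \<alpha> +
          h t * (\<alpha> * poly p t powr (\<alpha> - 1) * poly (pderiv p) t))) (at t)"
        unfolding \<phi>_def
        by (rule derivative_eq_intros h_deriv poly_DERIV DERIV_fun_powr refl p | use t t0 p in force)+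
      also have "poly p t powr \<alpha> = poly p t powr (\<alpha> - 1) * poly p t"
        using p by (simp add: powr_diff)
      also have "eval_fps (fps_deriv (Abs_fps c)) t * (poly p t powr (\<alpha> - 1) * poly p t) +
            h t * (\<alpha> * poly p t powr (\<alpha> - 1) * poly (pderiv p) t) =
          poly p t powr (\<alpha> - 1) * (poly p t * eval_fps (fps_deriv (Abs_fps c)) t + \<alpha> * poly (pderiv p) t * h t)"
        by (simp add: algebra_simps)
      also have "\<dots> = 0" using h_ode[of t] t t0 by simp
      finally show "(\<phi> has_real_derivative 0) (at t)" .
    qed
    also have "\<phi> 0 = 1" by (simp add: \<phi>_def h_def p0 eval_fps_at_0 c0)
    finally show ?thesis .
  qed
  have pos: "poly p t > 0" if t: "0 \<le> t" "t \<le> 1" for t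
  proof (rule ccontr)
    assume "\<not> poly p t > 0"
    define T where "T = {0..1} \<inter> {t. poly p t \<le> 0}"
    have "compact T" unfolding T_def
      by (intro compact_Int_closed closed_Collect_le continuous_intros) auto
    moreover have "T \<noteq> {}" using t \<open>\<not> poly p t > 0\<close> by (auto simp: T_def)
    ultimately obtain t0 where t0: "t0 \<in> T" and least: "\<And>t. t \<in> T \<Longrightarrow> t0 \<le> t"
      using compact_attains_inf by meson
    have t0': "0 \<le> t0" "t0 \<le> 1" "poly p t0 \<le> 0" using t0 by (auto simp: T_def)
    then have "0 < t0" using p0 by (cases "t0 = 0") auto
    have before: "poly p t > 0" if "0 \<le> t" "t < t0" for t
      using least[of t] that t0' by (force simp: T_def)
    \<comment> \<open>A negative value at \<open>t0\<close> would force an earlier zero by the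
      intermediate value theorem. A zero makes \<open>\<phi> t0\<close> vanish, although it has to
      be 1.\<close>
    have "poly p t0 = 0"
      using poly_IVT_neg[OF \<open>0 < t0\<close>, of p] p0 t0' before by (force simp: less_le)
    then show False using \<phi>_eq[OF \<open>0 < t0\<close> t0'(2) before] by (simp add: \<phi>_def)
  qed
  then show p1: "poly p 1 > 0" by simp
  have "\<phi> 1 = 1" using pos by (intro \<phi>_eq) (auto intro: less_imp_le)
  moreover have "h 1 = suminf c" by (simp add: h_def eval_fps_def)
  ultimately show "suminf c = poly p 1 powr (- \<alpha>)"
    using p1 by (simp add: \<phi>_def powr_minus field_simps)
qed

section \<open>Repeated indices\<close>

lemma block_index_eq:
  assumes "j < dim_vec k" "(\<Sum>l = 0..<j. k $ l) \<le> r" "r < (\<Sum>l = 0..j. k $ l)"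
  shows "block_index k r = j"
  unfolding block_index_def
proof (rule the_equality)
  have mono: "(\<Sum>l = 0..i. k $ l) \<le> (\<Sum>l = 0..<i'. k $ l)" if "i < i'" for i i'
    by (rule sum_mono2) (use that in auto)
  fix i assume "i < dim_vec k \<and> (\<Sum>l = 0..<i. k $ l) \<le> r \<and> r < (\<Sum>l = 0..i. k $ l)"
  then show "i = j" using assms mono[of i j] mono[of j i] by (cases i j rule: linorder_cases) auto
qed (use assms in auto)

text \<open>Induction over the blocks: the positions before the \<open>j\<close>-th partial sum
  carry exactly the labels below \<open>j\<close>, and the next block adds \<open>count K j\<close>
  copies of \<open>j\<close>.\<close>

lemma block_index_content:
  assumes K: "set_mset K \<subseteq> {..<n}"
  shows "image_mset (block_index (vec n (count K))) (mset_set {0..<size K}) = K"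
    and "(\<Sum>l = 0..<n. vec n (count K) $ l) = size K"
proof -
  let ?k = "vec n (count K)"
  have step: "filter_mset (\<lambda>i. i < Suc j) K = filter_mset (\<lambda>i. i < j) K + replicate_mset (count K j) j" for j
    by (rule multiset_eqI) (auto simp: less_Suc_eq)
  have *: "image_mset (block_index ?k) (mset_set {0..<(\<Sum>l = 0..<j. ?k $ l)}) = filter_mset (\<lambda>i. i < j) K"
    if "j \<le> n" for j
    using that
  proof (induction j)
    case (Suc j)
    let ?\<sigma> = "\<lambda>j. \<Sum>l = 0..<j. ?k $ l"
    have \<sigma>: "?\<sigma> (Suc j) = ?\<sigma> j + count K j" using Suc.prems by simp
    have "mset_set {0..<?\<sigma> (Suc j)} = mset_set ({0..<?\<sigma> j} \<union> {?\<sigma> j..<?\<sigma> (Suc j)})"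
      using \<sigma> by (intro arg_cong[where f = mset_set]) auto
    also have "\<dots> = mset_set {0..<?\<sigma> j} + mset_set {?\<sigma> j..<?\<sigma> (Suc j)}"
      by (rule mset_set_Union) auto
    finally have "image_mset (block_index ?k) (mset_set {0..<?\<sigma> (Suc j)}) =
        filter_mset (\<lambda>i. i < j) K + image_mset (block_index ?k) (mset_set {?\<sigma> j..<?\<sigma> (Suc j)})"
      using Suc by simp
    also have "image_mset (block_index ?k) (mset_set {?\<sigma> j..<?\<sigma> (Suc j)}) =
        image_mset (\<lambda>_. j) (mset_set {?\<sigma> j..<?\<sigma> (Suc j)})"
    proof (rule image_mset_cong)
      fix r assume "r \<in># mset_set {?\<sigma> j..<?\<sigma> (Suc j)}"
      then have "?\<sigma> j \<le> r" "r < ?\<sigma> (Suc j)" by (auto simp del: sum.op_ivl_Suc)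
      moreover have "{0..<Suc j} = {0..j}" by auto
      ultimately show "block_index ?k r = j"
        by (intro block_index_eq) (use Suc.prems in auto)
    qed
    also have "\<dots> = replicate_mset (count K j) j" using \<sigma> by (simp add: image_mset_const_eq)
    finally show ?case using step by simp
  qed simp
  have "filter_mset (\<lambda>i. i < n) K = K"
    using K by (intro filter_mset_eq_conv[THEN iffD2]) (auto simp: multiset_eq_iff not_in_iff)
  then have img: "image_mset (block_index ?k) (mset_set {0..<(\<Sum>l = 0..<n. ?k $ l)}) = K"
    using *[of n] by simp
  \<comment> \<open>The number of positions is read off by taking sizes on both sides.\<close>
  from arg_cong[OF this, of size] show size: "(\<Sum>l = 0..<n. ?k $ l) = size K" by simp
  show "image_mset (block_index ?k) (mset_set {0..<size K}) = K" using img unfolding size .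
qed

text \<open>Entries of the repeated matrix depend on positions only through
  \<open>block_index\<close>, which labels rows and columns alike, so the sum is determined by the
  multiset of labels.\<close>

lemma alpha_permanent_repeat_mat:
  assumes K: "set_mset K \<subseteq> {..<n}"
  shows "alpha_permanent \<alpha> (repeat_mat B (vec n (count K))) =
    mset_perm_sum \<alpha> (\<lambda>i j. B $$ (i, j)) (size K) K"
proof -
  let ?w = "block_index (vec n (count K))"
  have R: "repeat_mat B (vec n (count K)) =
      mat (size K) (size K) (\<lambda>(r, t). B $$ (?w r, ?w t))"
    unfolding repeat_mat_def by (simp add: Let_def block_index_content(2)[OF K, simplified])
  have "alpha_permanent \<alpha> (repeat_mat B (vec n (count K))) =
      perm_sum \<alpha> (\<lambda>i j. B $$ (i, j)) {0..<size K} ?w ?w"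
    unfolding R alpha_permanent_def perm_sum_def num_cycles_def
    by (intro sum.cong arg_cong2[where f = "(*)"] prod.cong) (auto simp: permutes_in_image)
  also have "\<dots> = mset_perm_sum \<alpha> (\<lambda>i j. B $$ (i, j)) (size K) K"
    by (rule perm_sum_content(1)) (use block_index_content(1)[OF K] in auto)
  finally show ?thesis .
qed

text \<open>Each label in \<open>K\<close> is the row label of one position, so the row factors come
  out of every product; a path sum has the extra row \<open>i\<close>. This is used to pass between
  \<open>B\<close> and \<open>C = (D + S)^-1 B\<close>.\<close>

lemma mset_perm_sum_scale:
  assumes "size K = m"
  shows "mset_perm_sum \<alpha> (\<lambda>i j. x i * C i j) m K = (\<Prod>i\<in>#K. x i) * mset_perm_sum \<alpha> C m K"
    and "mset_path_sum \<alpha> (\<lambda>i j. x i * C i j) m K i j = x i * (\<Prod>i\<in>#K. x i) * mset_path_sum \<alpha> C m K i j"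
  using assms
proof (induction m arbitrary: K i j)
  case 0
  {
    case 1
    then show ?case by simp
  next
    case 2
    then show ?case by simp
  }
next
  case (Suc m)
  \<comment> \<open>The factor \<open>x y\<close> missing from the smaller multiset returns through
    the distinguished row.\<close>
  have path: "mset_path_sum \<alpha> (\<lambda>i j. x i * C i j) m (K - {#y#}) y j =
      (\<Prod>i\<in>#K. x i) * mset_path_sum \<alpha> C m (K - {#y#}) y j" if "y \<in># K" "size K = Suc m" for K y j
  proof -
    have "size (K - {#y#}) = m" using that by (simp add: size_Diff_singleton)
    moreover have "(\<Prod>i\<in>#K. x i) = x y * (\<Prod>i\<in>#K - {#y#}. x i)"
      by (subst insert_DiffM[OF that(1), symmetric]) (simp del: insert_DiffM)
    ultimately show ?thesis using Suc.IH(2) by simp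
  qed
  have cyc: "mset_perm_sum \<alpha> (\<lambda>i j. x i * C i j) (Suc m) K = (\<Prod>i\<in>#K. x i) * mset_perm_sum \<alpha> C (Suc m) K"
    if "size K = Suc m" for K
    using path[OF _ that] by (simp add: sum_mset_distrib_left image_mset.compositionality comp_def
        cong: image_mset_cong)
  {
    case 1
    then show ?case by (rule cyc)
  next
    case 2
    have "(\<Sum>y\<in>#K. x i * C i y * mset_path_sum \<alpha> (\<lambda>i j. x i * C i j) m (K - {#y#}) y j) =
        (\<Sum>y\<in>#K. x i * (\<Prod>i\<in>#K. x i) * (C i y * mset_path_sum \<alpha> C m (K - {#y#}) y j))"
      using path[OF _ 2] by (intro arg_cong[where f = sum_mset] image_mset_cong) simp
    also have "\<dots> = x i * (\<Prod>i\<in>#K. x i) * (\<Sum>y\<in>#K. C i y * mset_path_sum \<alpha> C m (K - {#y#}) y j)"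
      by (simp only: sum_mset_distrib_left image_mset.compositionality comp_def)
    finally show ?case
      unfolding mset_path_sum.simps cyc[OF 2] by (simp only: distrib_left mult_ac)
  }
qed

lemma mset_perm_sum_nonneg:
  assumes "\<And>i j. i \<in> S \<Longrightarrow> j \<in> S \<Longrightarrow> C i j \<ge> 0" "\<alpha> \<ge> 0"
  shows "set_mset K \<subseteq> S \<Longrightarrow> mset_perm_sum \<alpha> C m K \<ge> 0"
    and "set_mset K \<subseteq> S \<Longrightarrow> i \<in> S \<Longrightarrow> j \<in> S \<Longrightarrow> mset_path_sum \<alpha> C m K i j \<ge> 0"
proof (induction m arbitrary: K i j)
  case 0
  {
    case 1
    then show ?case by simp
  next
    case 2
    then show ?case using assms by simp
  }
next
  case (Suc m)
  have path: "mset_path_sum \<alpha> C m (K - {#y#}) y j \<ge> 0" if "y \<in># K" "set_mset K \<subseteq> S" "j \<in> S" for K y j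
    using that in_diffD by (intro Suc.IH(2)) (fastforce)+
  have cyc: "mset_perm_sum \<alpha> C (Suc m) K \<ge> 0" if "set_mset K \<subseteq> S" for K
    unfolding mset_perm_sum.simps sum_mset_conv_count using that path
    by (intro divide_nonneg_nonneg sum_nonneg mult_nonneg_nonneg) auto
  {
    case 1
    then show ?case by (rule cyc)
  next
    case 2
    then show ?case
      unfolding mset_path_sum.simps sum_mset_conv_count using assms cyc path
      by (intro add_nonneg_nonneg mult_nonneg_nonneg sum_nonneg) auto
  }
qed

text \<open>Multi-indices correspond to multisets of labels below \<open>n\<close> through
  \<open>count\<close>. The sum is grouped by the total degree \<open>size K\<close>, the exponent
  in the generating function.\<close>

lemma nn_integral_count_space_vec:
  fixes g :: "nat vec \<Rightarrow> ennreal"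
  shows "(\<integral>\<^sup>+k. g k \<partial>count_space (carrier_vec n)) =
    (\<Sum>m. \<Sum>K\<in>multisets_of_size {..<n} m. g (vec n (count K)))"
proof -
  let ?A = "{K :: nat multiset. set_mset K \<subseteq> {..<n}}"
  let ?f = "\<lambda>K. vec n (count K)"
  have "bij_betw ?f ?A (carrier_vec n)"
  proof (rule bij_betw_imageI)
    show "inj_on ?f ?A"
    proof (rule inj_onI)
      fix K L assume K: "K \<in> ?A" "L \<in> ?A" and eq: "?f K = ?f L"
      show "K = L"
      proof (rule multiset_eqI)
        fix i
        have "count K i = count L i" if "i < n" using arg_cong[OF eq, of "\<lambda>v. v $ i"] that by simp
        moreover have "count K i = 0" "count L i = 0" if "\<not> i < n"
          using K that by (auto simp: count_eq_zero_iff)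
        ultimately show "count K i = count L i" by (cases "i < n") auto
      qed
    qed
    show "?f ` ?A = carrier_vec n"
    proof
      show "carrier_vec n \<subseteq> ?f ` ?A"
      proof
        fix k :: "nat vec" assume k: "k \<in> carrier_vec n"
        define K where "K = (\<Sum>i<n. replicate_mset (k $ i) i)"
        have "count K j = (if j < n then k $ j else 0)" for j
          by (simp add: K_def count_sum)
        then have "K \<in> ?A" "k = ?f K"
          using k by (auto simp flip: count_greater_zero_iff split: if_splits)
        then show "k \<in> ?f ` ?A" by blast
      qed
    qed auto
  qed
  then have "(\<integral>\<^sup>+k. g k \<partial>count_space (carrier_vec n)) = (\<integral>\<^sup>+K. g (?f K) \<partial>count_space ?A)"
    by (rule nn_integral_bij_count_space[symmetric])
  \<comment> \<open>The indicators single out one degree for each \<open>K\<close>, so that grouping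
    becomes an interchange of sum and integral.\<close>
  also have "\<dots> = (\<integral>\<^sup>+K. (\<Sum>m. g (?f K) * indicator {size K} m) \<partial>count_space ?A)"
  proof (rule nn_integral_cong)
    fix K
    have "(\<Sum>m. g (?f K) * indicator {size K} m) = (\<Sum>m\<in>{size K}. g (?f K) * indicator {size K} m)"
      by (rule suminf_finite) auto
    then show "g (?f K) = (\<Sum>m. g (?f K) * indicator {size K} m)" by simp
  qed
  also have "\<dots> = (\<Sum>m. \<integral>\<^sup>+K. g (?f K) * indicator {size K} m \<partial>count_space ?A)"
    by (rule nn_integral_suminf) simp
  also have "\<dots> = (\<Sum>m. \<Sum>K\<in>multisets_of_size {..<n} m. g (?f K))"
  proof (rule suminf_cong)
    fix m
    have "(\<integral>\<^sup>+K. g (?f K) * indicator {size K} m \<partial>count_space ?A) =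
        (\<Sum>K\<in>multisets_of_size {..<n} m. g (?f K) * indicator {size K} m)"
      by (rule nn_integral_count_space')
        (auto simp: multisets_of_size_def indicator_def
          finite_multisets_of_size[unfolded multisets_of_size_def])
    also have "\<dots> = (\<Sum>K\<in>multisets_of_size {..<n} m. g (?f K))"
      by (intro sum.cong) (auto simp: multisets_of_size_def)
    finally show "(\<integral>\<^sup>+K. g (?f K) * indicator {size K} m \<partial>count_space ?A) =
        (\<Sum>K\<in>multisets_of_size {..<n} m. g (?f K))" .
  qed
  finally show ?thesis .
qed

section \<open>Gamma mixtures\<close>

text \<open>Substitute \<open>t = (v + s) x\<close> in Euler's integral for
  \<open>Gamma u\<close>.\<close>

lemma nn_integral_gamma_density:
  assumes u: "u > 0" and v: "v > 0" and s: "s \<ge> 0"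
  shows "(\<integral>\<^sup>+x. ennreal (gamma_density u v x) * ennreal (exp (- s * x)) \<partial>lborel) =
    ennreal ((v / (v + s)) powr u)"
proof -
  define c where "c = v + s"
  have c: "c > 0" using v s by (simp add: c_def)
  have G: "Gamma u > 0" using u by (rule Gamma_real_pos)
  let ?g = "\<lambda>t :: real. indicator {0..} t * t powr (u - 1) / exp t"
  have "ennreal (Gamma u) = (\<integral>\<^sup>+t. ennreal (?g t) \<partial>lborel)"
    by (rule Gamma_conv_nn_integral_real[OF u])
  also have "\<dots> = ennreal c * (\<integral>\<^sup>+x. ennreal (?g (0 + c * x)) \<partial>lborel)"
    using c by (subst nn_integral_real_affine[where c = c and t = 0]) auto
  finally have *: "ennreal (Gamma u) = ennreal c * (\<integral>\<^sup>+x. ennreal (?g (c * x)) \<partial>lborel)" by simp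
  have "ennreal (gamma_density u v x) * ennreal (exp (- s * x)) =
      ennreal (v powr u / Gamma u * c powr - u) * (ennreal c * ennreal (?g (c * x)))" for x
  proof (cases "x > 0")
    case True
    have "v powr u * x powr (u - 1) * exp (- v * x) / Gamma u * exp (- s * x) =
        v powr u / Gamma u * c powr - u * (c * ((c * x) powr (u - 1) / exp (c * x)))"
    proof -
      have e: "exp (- v * x) * exp (- s * x) = inverse (exp (c * x))"
        unfolding exp_add[symmetric] exp_minus[symmetric] by (simp add: c_def algebra_simps)
      have p: "c * (c * x) powr (u - 1) = c powr u * x powr (u - 1)"
        using c True by (simp add: powr_mult powr_diff)
      have "v powr u * x powr (u - 1) * exp (- v * x) / Gamma u * exp (- s * x) =
          v powr u / Gamma u * x powr (u - 1) * (exp (- v * x) * exp (- s * x))" by simp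
      also have "\<dots> = v powr u / Gamma u * x powr (u - 1) / exp (c * x)"
        unfolding e by (simp add: divide_inverse)
      also have "\<dots> = v powr u / Gamma u * c powr - u * (c powr u * x powr (u - 1)) / exp (c * x)"
        using c by (simp add: powr_minus)
      also have "\<dots> = v powr u / Gamma u * c powr - u * (c * ((c * x) powr (u - 1) / exp (c * x)))"
        unfolding p[symmetric] by simp
      finally show ?thesis .
    qed
    then show ?thesis
      using True c G by (simp add: gamma_density_def ennreal_mult'[symmetric])
  next
    case False
    \<comment> \<open>At \<open>x = 0\<close> the right side vanishes as well, because
      \<open>0 powr (u - 1)\<close> is 0.\<close>
    then show ?thesis using c by (cases "x = 0") (auto simp: gamma_density_def mult_le_0_iff zero_le_mult_iff)
  qed
  then have "(\<integral>\<^sup>+x. ennreal (gamma_density u v x) * ennreal (exp (- s * x)) \<partial>lborel) =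
      ennreal (v powr u / Gamma u * c powr - u) * (ennreal c * (\<integral>\<^sup>+x. ennreal (?g (c * x)) \<partial>lborel))"
    by (simp add: nn_integral_cmult)
  also have "\<dots> = ennreal (v powr u / Gamma u * c powr - u) * ennreal (Gamma u)"
    by (simp only: *)
  also have "\<dots> = ennreal ((v / c) powr u)"
    using G c v by (simp add: ennreal_mult''[symmetric] powr_divide powr_minus field_simps)
  finally show ?thesis by (simp add: c_def)
qed

text \<open>Splitting over the value of \<open>Z\<close> makes the random index a fixed one. After
  the countable sum and the expectation are interchanged, independence is applied for each
  \<open>k\<close> separately. With every \<open>f i\<close> equal to 1 this computes the total mass
  of the law of \<open>Z\<close>.\<close>

lemma (in prob_space) nn_integral_indep_mixture:
  fixes f :: "nat \<Rightarrow> real \<Rightarrow> ennreal"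
  assumes I: "countable I" and Z: "Z \<in> measurable M (count_space I)"
    and \<xi>: "\<And>k i. k \<in> I \<Longrightarrow> i < n \<Longrightarrow> \<xi> k i \<in> borel_measurable M"
    and f: "\<And>i. i < n \<Longrightarrow> f i \<in> borel_measurable borel"
    and indep: "indep_sets
        (\<lambda>j. case j of
            None \<Rightarrow> {Z -` E \<inter> space M | E. E \<in> sets (count_space I)}
          | Some (k, i) \<Rightarrow> {\<xi> k i -` E \<inter> space M | E. E \<in> sets borel})
        (insert None (Some ` (I \<times> {0..<n})))"
  shows "(\<integral>\<^sup>+\<omega>. (\<Prod>i = 0..<n. f i (\<xi> (Z \<omega>) i \<omega>)) \<partial>M) =
    (\<integral>\<^sup>+k. emeasure M {\<omega> \<in> space M. Z \<omega> = k} * (\<Prod>i = 0..<n. \<integral>\<^sup>+\<omega>. f i (\<xi> k i \<omega>) \<partial>M) \<partial>count_space I)"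
proof -
  have ZI: "Z \<omega> \<in> I" if "\<omega> \<in> space M" for \<omega> using measurable_space[OF Z that] by simp
  have [measurable]: "(\<lambda>\<omega>. indicator {k} (Z \<omega>) :: ennreal) \<in> borel_measurable M" for k
    by (rule measurable_compose[OF Z]) simp
  have f\<xi> [measurable]: "(\<lambda>\<omega>. f i (\<xi> k i \<omega>)) \<in> borel_measurable M" if "k \<in> I" "i < n" for k i
    using that by (intro measurable_compose[OF \<xi> f])
  have "(\<integral>\<^sup>+\<omega>. (\<Prod>i = 0..<n. f i (\<xi> (Z \<omega>) i \<omega>)) \<partial>M) =
      (\<integral>\<^sup>+\<omega>. \<integral>\<^sup>+k. indicator {k} (Z \<omega>) * (\<Prod>i = 0..<n. f i (\<xi> k i \<omega>)) \<partial>count_space I \<partial>M)"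
  proof (rule nn_integral_cong)
    fix \<omega> assume "\<omega> \<in> space M"
    then show "(\<Prod>i = 0..<n. f i (\<xi> (Z \<omega>) i \<omega>)) =
        (\<integral>\<^sup>+k. indicator {k} (Z \<omega>) * (\<Prod>i = 0..<n. f i (\<xi> k i \<omega>)) \<partial>count_space I)"
      using ZI by (subst nn_integral_count_space'[where A = "{Z \<omega>}"]) auto
  qed
  also have "\<dots> = (\<integral>\<^sup>+k. \<integral>\<^sup>+\<omega>. indicator {k} (Z \<omega>) * (\<Prod>i = 0..<n. f i (\<xi> k i \<omega>)) \<partial>M \<partial>count_space I)"
    using I by (rule nn_integral_count_space_nn_integral) simp
  also have "\<dots> = (\<integral>\<^sup>+k. emeasure M {\<omega> \<in> space M. Z \<omega> = k} *
      (\<Prod>i = 0..<n. \<integral>\<^sup>+\<omega>. f i (\<xi> k i \<omega>) \<partial>M) \<partial>count_space I)"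
  proof (rule nn_integral_cong)
    fix k assume "k \<in> space (count_space I)"
    then have k: "k \<in> I" by simp
    \<comment> \<open>For fixed \<open>k\<close> only the event \<open>Z = k\<close> and the
      \<open>n\<close> variables indexed by \<open>k\<close> occur: a finite subfamily, of which
      \<open>Y\<close> takes measurable functions.\<close>
    define J where "J = insert None (Some ` ({k} \<times> {0..<n}))"
    define Y where "Y j \<omega> = (case j of None \<Rightarrow> indicator {k} (Z \<omega>) | Some (k, i) \<Rightarrow> f i (\<xi> k i \<omega>))" for j \<omega>
    have J: "finite J" by (simp add: J_def)
    have prod_J: "(\<Prod>j\<in>J. g j) = g None * (\<Prod>i = 0..<n. g (Some (k, i)))" for g :: "_ \<Rightarrow> ennreal"
    proof -
      have "Some ` ({k} \<times> {0..<n}) = (\<lambda>i. Some (k, i)) ` {0..<n}" by auto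
      then show ?thesis
        unfolding J_def by (subst prod.insert) (auto simp: prod.reindex inj_on_def)
    qed
    have "indep_vars (\<lambda>_. borel) Y J"
      unfolding indep_vars_def2
    proof
      show "\<forall>j\<in>J. random_variable borel (Y j)"
        using k unfolding J_def Y_def by auto
      show "indep_sets (\<lambda>j. {Y j -` A \<inter> space M | A. A \<in> sets borel}) J"
      proof (rule indep_sets_mono[OF indep])
        show "J \<subseteq> insert None (Some ` (I \<times> {0..<n}))" using k by (auto simp: J_def)
        fix j assume "j \<in> J"
        then consider "j = None" | i where "j = Some (k, i)" "i < n" by (auto simp: J_def)
        then show "{Y j -` A \<inter> space M | A. A \<in> sets borel} \<subseteq> (case j of
            None \<Rightarrow> {Z -` E \<inter> space M | E. E \<in> sets (count_space I)}
          | Some (k, i) \<Rightarrow> {\<xi> k i -` E \<inter> space M | E. E \<in> sets borel})"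
        proof cases
          case 1
          have "Y None -` A \<inter> space M = Z -` {z \<in> I. indicator {k} z \<in> A} \<inter> space M" for A
            using ZI by (auto simp: Y_def)
          moreover have "{z \<in> I. indicator {k} z \<in> A} \<in> sets (count_space I)" for A :: "ennreal set"
            by auto
          ultimately show ?thesis unfolding 1 option.case by blast
        next
          case 2
          have "{Y j -` A \<inter> space M | A. A \<in> sets borel} \<subseteq> {\<xi> k i -` E \<inter> space M | E. E \<in> sets borel}"
          proof
            fix S assume "S \<in> {Y j -` A \<inter> space M | A. A \<in> sets borel}"
            then obtain A where A: "A \<in> sets borel" and S: "S = Y j -` A \<inter> space M" by blast
            have "S = \<xi> k i -` (f i -` A) \<inter> space M"
              using 2 by (auto simp: Y_def S)
            moreover have "f i -` A \<in> sets borel"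
              using measurable_sets[OF f[OF 2(2)] A] by simp
            ultimately show "S \<in> {\<xi> k i -` E \<inter> space M | E. E \<in> sets borel}" by blast
          qed
          then show ?thesis by (simp only: 2(1) option.case prod.case)
        qed
      qed
    qed
    then have "(\<integral>\<^sup>+\<omega>. (\<Prod>j\<in>J. Y j \<omega>) \<partial>M) = (\<Prod>j\<in>J. \<integral>\<^sup>+\<omega>. Y j \<omega> \<partial>M)"
      by (intro indep_vars_nn_integral J) auto
    moreover have "(\<integral>\<^sup>+\<omega>. Y None \<omega> \<partial>M) = emeasure M {\<omega> \<in> space M. Z \<omega> = k}"
    proof -
      have "(\<integral>\<^sup>+\<omega>. Y None \<omega> \<partial>M) = (\<integral>\<^sup>+\<omega>. indicator {\<omega> \<in> space M. Z \<omega> = k} \<omega> \<partial>M)"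
        by (intro nn_integral_cong) (auto simp: Y_def indicator_def)
      moreover have "{\<omega> \<in> space M. Z \<omega> = k} \<in> sets M"
        using measurable_sets[OF Z, of "{k}"] k by (simp add: vimage_def Int_def conj_commute)
      ultimately show ?thesis by simp
    qed
    ultimately show "(\<integral>\<^sup>+\<omega>. indicator {k} (Z \<omega>) * (\<Prod>i = 0..<n. f i (\<xi> k i \<omega>)) \<partial>M) =
        emeasure M {\<omega> \<in> space M. Z \<omega> = k} * (\<Prod>i = 0..<n. \<integral>\<^sup>+\<omega>. f i (\<xi> k i \<omega>) \<partial>M)"
      unfolding prod_J by (simp add: Y_def[abs_def])
  qed
  finally show ?thesis .
qed

section \<open>The Laplace transform\<close>

lemma perm_coeff_nonneg:
  assumes "\<And>i j. i < n \<Longrightarrow> j < n \<Longrightarrow> C i j \<ge> 0" "\<alpha> \<ge> 0"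
  shows "perm_coeff \<alpha> C n m \<ge> 0"
  unfolding perm_coeff_def
proof (intro sum_nonneg divide_nonneg_pos mset_fact_pos)
  fix K assume "K \<in> multisets_of_size {..<n} m"
  then show "mset_perm_sum \<alpha> C m K \<ge> 0"
    by (intro mset_perm_sum_nonneg(1)[of "{..<n}"]) (use assms in \<open>auto simp: multisets_of_size_def\<close>)
qed

text \<open>Evaluation at \<open>t\<close> is a ring homomorphism and commutes with
  \<open>det\<close>. Thus \<open>det N\<close> is a polynomial with value 1 at \<open>t = 0\<close>
  and the wanted determinant at \<open>t = 1\<close>.\<close>

lemma suminf_perm_coeff:
  fixes C :: "nat \<Rightarrow> nat \<Rightarrow> real"
  assumes C: "\<And>i j. i < n \<Longrightarrow> j < n \<Longrightarrow> C i j \<ge> 0" and \<alpha>: "\<alpha> > 0"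
    and summ: "summable (perm_coeff \<alpha> C n)"
  shows "det (1\<^sub>m n - mat n n (\<lambda>(i, j). C i j)) > 0"
    and "suminf (perm_coeff \<alpha> C n) = det (1\<^sub>m n - mat n n (\<lambda>(i, j). C i j)) powr (- \<alpha>)"
proof -
  define N where "N = mat n n (\<lambda>(i, j). (if i = j then 1 else 0) - [:0, C i j:])"
  have eval: "poly (det N) t = det (map_mat (\<lambda>p. poly p t) N)" for t
    by (rule comm_ring_hom.hom_det[symmetric]) (unfold_locales, auto)
  have "map_mat (\<lambda>p. poly p 0) N = 1\<^sub>m n" "map_mat (\<lambda>p. poly p 1) N = 1\<^sub>m n - mat n n (\<lambda>(i, j). C i j)"
    by (rule eq_matI; simp add: N_def)+
  then have p0: "poly (det N) 0 = 1" and p1: "poly (det N) 1 = det (1\<^sub>m n - mat n n (\<lambda>(i, j). C i j))"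
    by (simp_all add: eval)
  note * = perm_coeff_nonneg[OF C less_imp_le[OF \<alpha>]] perm_coeff_0 summ p0 \<alpha>
    perm_coeff_fps_deriv[of n C \<alpha>, folded N_def]
  show "det (1\<^sub>m n - mat n n (\<lambda>(i, j). C i j)) > 0"
    using suminf_eq_powr_of_ode(1)[OF *] unfolding p1 by simp
  show "suminf (perm_coeff \<alpha> C n) = det (1\<^sub>m n - mat n n (\<lambda>(i, j). C i j)) powr (- \<alpha>)"
    using suminf_eq_powr_of_ode(2)[OF *] unfolding p1 by simp
qed

text \<open>In entry \<open>(i, i)\<close> of \<open>A * A'\<close>, which is 1, all summands off
  the diagonal of \<open>A\<close> are at most 0, so the remaining product is positive.\<close>

lemma nonsingular_M_matrix_diag_pos:
  assumes A: "A \<in> carrier_mat n n" and M: "nonsingular_M_matrix A" and i: "i < n"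
  shows "A $$ (i, i) > 0"
proof -
  obtain A' where A': "A' \<in> carrier_mat n n" "inverts_mat A A'"
    and nonneg: "\<And>i j. i < n \<Longrightarrow> j < n \<Longrightarrow> A' $$ (i, j) \<ge> 0"
    using M A by (auto simp: nonsingular_M_matrix_def)
  have off: "A $$ (i, j) \<le> 0" if "j < n" "j \<noteq> i" for j
    using M A i that by (auto simp: nonsingular_M_matrix_def)
  have "1 = (A * A') $$ (i, i)" using A' A i by (simp add: inverts_mat_def)
  also have "\<dots> = (\<Sum>j = 0..<n. A $$ (i, j) * A' $$ (j, i))"
    using A A' i by (simp add: scalar_prod_def)
  also have "\<dots> = A $$ (i, i) * A' $$ (i, i) + (\<Sum>j\<in>{0..<n} - {i}. A $$ (i, j) * A' $$ (j, i))"
    using i by (intro sum.remove) auto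
  also have "(\<Sum>j\<in>{0..<n} - {i}. A $$ (i, j) * A' $$ (j, i)) \<le> 0"
    by (intro sum_nonpos mult_nonpos_nonneg) (use off nonneg i in auto)
  finally have "A $$ (i, i) * A' $$ (i, i) > 0" by simp
  then show ?thesis using nonneg[OF i i] by (simp add: zero_less_mult_iff)
qed

lemma nonsingular_M_matrix_det:
  assumes A: "A \<in> carrier_mat n n" and M: "nonsingular_M_matrix A"
  shows "det A \<noteq> 0"
proof -
  obtain A' where A': "A' \<in> carrier_mat n n" "inverts_mat A A'"
    using M A by (auto simp: nonsingular_M_matrix_def)
  then have "det A * det A' = 1"
    using det_mult[OF A A'(1)] A by (simp add: inverts_mat_def)
  then show ?thesis by auto
qed

lemma det_mat_diag: "det (mat_diag n f) = (\<Prod>i = 0..<n. f i)"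
  for f :: "nat \<Rightarrow> 'a :: comm_ring_1"
proof -
  have "upper_triangular (mat_diag n f)" by (auto simp: mat_diag_def)
  then have "det (mat_diag n f) = prod_list (diag_mat (mat_diag n f))"
    by (rule det_upper_triangular[of _ n]) simp
  also have "diag_mat (mat_diag n f) = map f [0..<n]"
    by (auto simp: diag_mat_def mat_diag_def)
  finally show ?thesis by (simp add: prod.list_conv_set_nth)
qed

theorem theorem2p1:
  fixes A B D :: "real mat"
    and n :: nat
    and \<alpha> :: real
    and M :: "'w measure"
    and Z :: "'w \<Rightarrow> nat vec"
    and \<xi> :: "nat vec \<Rightarrow> nat \<Rightarrow> 'w \<Rightarrow> real"
    and X :: "'w \<Rightarrow> real vec"
  assumes A_carrier: "A \<in> carrier_mat n n"
    and A_M_matrix: "nonsingular_M_matrix A"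
    and D_eq: "D = mat_diag n (\<lambda>i. A $$ (i, i))"
    and B_eq: "B = D - A"
    and alpha_pos: "\<alpha> > 0"
    and M_prob: "prob_space M"
    and Z_rv: "Z \<in> measurable M (count_space (carrier_vec n))"
    and Z_dist: "\<And>k. k \<in> carrier_vec n \<Longrightarrow>
        measure M {\<omega> \<in> space M. Z \<omega> = k} =
          det A powr \<alpha> / (\<Prod>i = 0..<n. A $$ (i, i) powr \<alpha>) *
          (alpha_permanent \<alpha> (repeat_mat B k) /
            (\<Prod>i = 0..<n. A $$ (i, i) ^ (k $ i) * fact (k $ i)))"
    and xi_dist: "\<And>k i. k \<in> carrier_vec n \<Longrightarrow> i < n \<Longrightarrow>
        distributed M lborel (\<xi> k i)
          (\<lambda>x. ennreal (gamma_density (\<alpha> + real (k $ i)) (A $$ (i, i)) x))"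
    and Z_xi_indep: "prob_space.indep_sets M
        (\<lambda>j. case j of
            None \<Rightarrow> {Z -` E \<inter> space M | E. E \<in> sets (count_space (carrier_vec n))}
          | Some (k, i) \<Rightarrow> {\<xi> k i -` E \<inter> space M | E. E \<in> sets borel})
        (insert None (Some ` (carrier_vec n \<times> {0..<n})))"
    and X_eq: "\<And>\<omega>. \<omega> \<in> space M \<Longrightarrow> X \<omega> = vec n (\<lambda>i. \<xi> (Z \<omega>) i \<omega>)"
  shows "\<forall>s \<in> carrier_vec n. (\<forall>i < n. s $ i \<ge> 0) \<longrightarrow>
      (\<integral>\<omega>. exp (- (\<Sum>i = 0..<n. s $ i * X \<omega> $ i)) \<partial>M) =
        det A powr \<alpha> / det (A + mat_diag n (\<lambda>i. s $ i)) powr \<alpha>"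
proof (intro ballI impI)
  fix s :: "real vec" assume "s \<in> carrier_vec n" and "\<forall>i<n. s $ i \<ge> 0"
  then have s: "s $ i \<ge> 0" if "i < n" for i using that by simp
  interpret prob_space M by (rule M_prob)
  define a where "a i = A $$ (i, i)" for i
  \<comment> \<open>The diagonal of \<open>(D + S)^-1\<close>, so \<open>C\<close> is
    \<open>(D + S)^-1 B\<close>. The constant \<open>\<kappa>\<close> collects the factors
    independent of \<open>k\<close>; the powers \<open>a i powr \<alpha>\<close> from the gamma
    transforms cancel those in the law of \<open>Z\<close>.\<close>
  define x where "x i = 1 / (a i + s $ i)" for i
  define C where "C i j = x i * B $$ (i, j)" for i j
  define \<kappa> where "\<kappa> = det A powr \<alpha> * (\<Prod>i = 0..<n. x i powr \<alpha>)"
  \<comment> \<open>The extended non-negative integral allows interchanges before \<open>L\<close>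
    is known to be finite.\<close>
  define L where "L = (\<integral>\<^sup>+\<omega>. ennreal (exp (- (\<Sum>i = 0..<n. s $ i * X \<omega> $ i))) \<partial>M)"
  have a: "a i > 0" if "i < n" for i
    unfolding a_def by (rule nonsingular_M_matrix_diag_pos[OF A_carrier A_M_matrix that])
  have x: "x i > 0" if "i < n" for i using a[OF that] s[OF that] by (simp add: x_def)
  have B: "B $$ (i, j) = (if i = j then 0 else - A $$ (i, j))" if "i < n" "j < n" for i j
    using that A_carrier by (auto simp: B_eq D_eq mat_diag_def)
  have C: "C i j \<ge> 0" if "i < n" "j < n" for i j
  proof -
    have "B $$ (i, j) \<ge> 0"
      using that A_carrier A_M_matrix by (auto simp: B nonsingular_M_matrix_def)
    then show ?thesis using x[OF that(1)] by (simp add: C_def)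
  qed
  have \<kappa>: "\<kappa> > 0"
  proof -
    have "x i powr \<alpha> > 0" if "i < n" for i using x[OF that] by simp
    \<comment> \<open>\<open>powr\<close> is positive at every nonzero base, so
      \<open>det A \<noteq> 0\<close> is enough here.\<close>
    then show ?thesis
      using nonsingular_M_matrix_det[OF A_carrier A_M_matrix]
      by (auto simp: \<kappa>_def intro!: mult_pos_pos prod_pos)
  qed
  have cnt: "countable (carrier_vec n :: nat vec set)"
  proof (rule countable_subset)
    show "(carrier_vec n :: nat vec set) \<subseteq> range vec_of_list" by (metis subsetI rangeI vec_list)
  qed simp
  have \<xi>_meas: "\<xi> k i \<in> borel_measurable M" if "k \<in> carrier_vec n" "i < n" for k i
    using distributed_measurable[OF xi_dist[OF that]] by simp
  have X_nth: "X \<omega> $ i = \<xi> (Z \<omega>) i \<omega>" if "\<omega> \<in> space M" "i < n" for \<omega> i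
    using that by (simp add: X_eq)

  \<comment> \<open>The Laplace transform as a series\<close>
  have "L = (\<integral>\<^sup>+\<omega>. (\<Prod>i = 0..<n. ennreal (exp (- s $ i * \<xi> (Z \<omega>) i \<omega>))) \<partial>M)"
    unfolding L_def
    by (intro nn_integral_cong) (simp add: prod_ennreal sum_negf[symmetric] exp_sum X_nth)
  also have "\<dots> = (\<integral>\<^sup>+k. emeasure M {\<omega> \<in> space M. Z \<omega> = k} *
      (\<Prod>i = 0..<n. \<integral>\<^sup>+\<omega>. ennreal (exp (- s $ i * \<xi> k i \<omega>)) \<partial>M) \<partial>count_space (carrier_vec n))"
    by (rule nn_integral_indep_mixture[OF cnt Z_rv \<xi>_meas _ Z_xi_indep]) auto
  also have "\<dots> = (\<integral>\<^sup>+k. ennreal (measure M {\<omega> \<in> space M. Z \<omega> = k} *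
      (\<Prod>i = 0..<n. (a i * x i) powr (\<alpha> + real (k $ i)))) \<partial>count_space (carrier_vec n))"
  proof (rule nn_integral_cong)
    fix k :: "nat vec" assume "k \<in> space (count_space (carrier_vec n))"
    then have k: "k \<in> carrier_vec n" by simp
    have "(\<integral>\<^sup>+\<omega>. ennreal (exp (- s $ i * \<xi> k i \<omega>)) \<partial>M) = ennreal ((a i * x i) powr (\<alpha> + real (k $ i)))"
      if i: "i < n" for i
    proof -
      have "(\<integral>\<^sup>+\<omega>. ennreal (exp (- s $ i * \<xi> k i \<omega>)) \<partial>M) =
          (\<integral>\<^sup>+y. ennreal (gamma_density (\<alpha> + real (k $ i)) (a i) y) * ennreal (exp (- s $ i * y)) \<partial>lborel)"
        using distributed_nn_integral[OF xi_dist[OF k i], of "\<lambda>y. ennreal (exp (- s $ i * y))"]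
        by (simp add: a_def)
      also have "\<dots> = ennreal ((a i * x i) powr (\<alpha> + real (k $ i)))"
        using nn_integral_gamma_density[of "\<alpha> + real (k $ i)" "a i" "s $ i"] alpha_pos a[OF i] s[OF i]
        by (simp add: x_def)
      finally show ?thesis .
    qed
    then show "emeasure M {\<omega> \<in> space M. Z \<omega> = k} *
        (\<Prod>i = 0..<n. \<integral>\<^sup>+\<omega>. ennreal (exp (- s $ i * \<xi> k i \<omega>)) \<partial>M) =
        ennreal (measure M {\<omega> \<in> space M. Z \<omega> = k} * (\<Prod>i = 0..<n. (a i * x i) powr (\<alpha> + real (k $ i))))"
      by (simp add: prod_ennreal emeasure_eq_measure ennreal_mult prod_nonneg)
  qed
  finally have L_mixture: "L = (\<integral>\<^sup>+k. ennreal (measure M {\<omega> \<in> space M. Z \<omega> = k} *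
      (\<Prod>i = 0..<n. (a i * x i) powr (\<alpha> + real (k $ i)))) \<partial>count_space (carrier_vec n))" .
  also have "\<dots> = (\<Sum>m. \<Sum>K\<in>multisets_of_size {..<n} m.
      ennreal (measure M {\<omega> \<in> space M. Z \<omega> = vec n (count K)} *
        (\<Prod>i = 0..<n. (a i * x i) powr (\<alpha> + real (vec n (count K) $ i)))))"
    by (rule nn_integral_count_space_vec)
  also have "\<dots> = (\<Sum>m. ennreal (\<kappa> * perm_coeff \<alpha> C n m))"
  proof (rule suminf_cong)
    fix m
    have "measure M {\<omega> \<in> space M. Z \<omega> = vec n (count K)} *
        (\<Prod>i = 0..<n. (a i * x i) powr (\<alpha> + real (vec n (count K) $ i))) =
        \<kappa> * (mset_perm_sum \<alpha> C m K / mset_fact n K)" if "K \<in> multisets_of_size {..<n} m" for K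
    proof -
      have K: "set_mset K \<subseteq> {..<n}" "size K = m" using that by (auto simp: multisets_of_size_def)
      have "(\<Prod>i\<in>#K. x i) = (\<Prod>i\<in>set_mset K. x i ^ count K i)"
        by (rule image_prod_mset_multiplicity)
      also have "\<dots> = (\<Prod>i<n. x i ^ count K i)"
        by (rule prod.mono_neutral_left) (use K in \<open>auto simp: not_in_iff\<close>)
      finally have gen: "mset_perm_sum \<alpha> C m K =
          (\<Prod>i<n. x i ^ count K i) * alpha_permanent \<alpha> (repeat_mat B (vec n (count K)))"
        using mset_perm_sum_scale(1)[OF K(2), of \<alpha> x "\<lambda>i j. B $$ (i, j)"]
          alpha_permanent_repeat_mat[OF K(1), of \<alpha> B] K(2)
        by (simp add: C_def[abs_def])
      \<comment> \<open>The powers of \<open>a i\<close> will cancel against the law of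
        \<open>Z\<close>; those of \<open>x i\<close> are shared between \<open>\<kappa>\<close> and
        the scaling of \<open>B\<close> to \<open>C\<close>.\<close>
      have power: "(\<Prod>i<n. (a i * x i) powr (\<alpha> + real (count K i))) =
          (\<Prod>i<n. a i powr \<alpha>) * (\<Prod>i<n. a i ^ count K i) *
          ((\<Prod>i<n. x i powr \<alpha>) * (\<Prod>i<n. x i ^ count K i))"
        unfolding prod.distrib[symmetric]
        by (intro prod.cong refl) (use a x in \<open>simp add: powr_add powr_mult powr_realpow power_mult_distrib\<close>)
      have "(\<Prod>i<n. a i powr \<alpha>) \<noteq> 0" "(\<Prod>i<n. a i ^ count K i) \<noteq> 0"
        using a by fastforce+
      then show ?thesis
        using Z_dist[of "vec n (count K)"]
        by (simp add: power gen \<kappa>_def a_def[symmetric] prod.distrib mset_fact_def atLeast0LessThan field_simps)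
    qed
    then have "(\<Sum>K\<in>multisets_of_size {..<n} m. ennreal (measure M {\<omega> \<in> space M. Z \<omega> = vec n (count K)} *
        (\<Prod>i = 0..<n. (a i * x i) powr (\<alpha> + real (vec n (count K) $ i))))) =
        ennreal (\<Sum>K\<in>multisets_of_size {..<n} m. measure M {\<omega> \<in> space M. Z \<omega> = vec n (count K)} *
        (\<Prod>i = 0..<n. (a i * x i) powr (\<alpha> + real (vec n (count K) $ i))))"
      by (intro sum_ennreal mult_nonneg_nonneg prod_nonneg) auto
    also have "\<dots> = ennreal (\<kappa> * perm_coeff \<alpha> C n m)"
      unfolding perm_coeff_def sum_distrib_left
      by (intro arg_cong[where f = ennreal] sum.cong refl) fact
    finally show "(\<Sum>K\<in>multisets_of_size {..<n} m. ennreal (measure M {\<omega> \<in> space M. Z \<omega> = vec n (count K)} *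
        (\<Prod>i = 0..<n. (a i * x i) powr (\<alpha> + real (vec n (count K) $ i))))) =
        ennreal (\<kappa> * perm_coeff \<alpha> C n m)" .
  qed
  finally have L_series: "L = (\<Sum>m. ennreal (\<kappa> * perm_coeff \<alpha> C n m))" .

  \<comment> \<open>Summability from the bound on the transform\<close>
  have nonneg: "\<kappa> * perm_coeff \<alpha> C n m \<ge> 0" for m
    using \<kappa> perm_coeff_nonneg[OF C] alpha_pos by (simp add: zero_le_mult_iff)
  \<comment> \<open>Replacing every gamma transform by 1 leaves the total mass of the law of
    \<open>Z\<close>, evaluated by the mixture lemma with constant functions.\<close>
  have "L \<le> (\<integral>\<^sup>+k. emeasure M {\<omega> \<in> space M. Z \<omega> = k} * (\<Prod>i = 0..<n. \<integral>\<^sup>+\<omega>. 1 \<partial>M) \<partial>count_space (carrier_vec n))"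
    unfolding L_mixture
  proof (rule nn_integral_mono)
    fix k :: "nat vec"
    have "a i * x i \<le> 1" "a i * x i > 0" if "i < n" for i
      using a[OF that] s[OF that] x[OF that] by (simp_all add: x_def)
    then have "(a i * x i) powr (\<alpha> + real (k $ i)) \<le> 1" if "i < n" for i
      using alpha_pos that by (intro powr_le1) (simp_all add: abs_of_pos)
    then have "(\<Prod>i = 0..<n. (a i * x i) powr (\<alpha> + real (k $ i))) \<le> 1"
      by (intro prod_le_1) auto
    then have "measure M {\<omega> \<in> space M. Z \<omega> = k} * (\<Prod>i = 0..<n. (a i * x i) powr (\<alpha> + real (k $ i))) \<le>
        measure M {\<omega> \<in> space M. Z \<omega> = k}"
      by (intro mult_left_le) auto
    then show "ennreal (measure M {\<omega> \<in> space M. Z \<omega> = k} * (\<Prod>i = 0..<n. (a i * x i) powr (\<alpha> + real (k $ i)))) \<le>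
        emeasure M {\<omega> \<in> space M. Z \<omega> = k} * (\<Prod>i = 0..<n. \<integral>\<^sup>+\<omega>. 1 \<partial>M)"
      by (simp add: emeasure_eq_measure prob_space ennreal_leI)
  qed
  also have "\<dots> = (\<integral>\<^sup>+\<omega>. (\<Prod>i = 0..<n. 1) \<partial>M)"
    by (rule nn_integral_indep_mixture[OF cnt Z_rv \<xi>_meas _ Z_xi_indep, symmetric]) auto
  finally have "L \<noteq> top_class.top" by (auto simp: emeasure_space_1 top_unique)
  then have summ: "summable (\<lambda>m. \<kappa> * perm_coeff \<alpha> C n m)"
    using nonneg unfolding L_series by (intro summable_suminf_not_top)
  then have summ': "summable (perm_coeff \<alpha> C n)" using \<kappa> by (simp add: summable_cmult_iff)
  define d where "d = det (1\<^sub>m n - mat n n (\<lambda>(i, j). C i j))"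
  have d: "d > 0" and sum_d: "suminf (perm_coeff \<alpha> C n) = d powr (- \<alpha>)"
    using suminf_perm_coeff[OF C alpha_pos summ'] by (simp_all add: d_def)
  have L: "L = ennreal (\<kappa> * d powr (- \<alpha>))"
    unfolding L_series using suminf_ennreal2[OF nonneg summ] suminf_mult[OF summ', of \<kappa>] by (simp add: sum_d)

  \<comment> \<open>Determinant factorization and return to the expectation\<close>
  have "A + mat_diag n (\<lambda>i. s $ i) =
      mat_diag n (\<lambda>i. a i + s $ i) * (1\<^sub>m n - mat n n (\<lambda>(i, j). C i j))"
  proof (rule eq_matI)
    fix i j assume "i < dim_row (mat_diag n (\<lambda>i. a i + s $ i) * (1\<^sub>m n - mat n n (\<lambda>(i, j). C i j)))"
      "j < dim_col (mat_diag n (\<lambda>i. a i + s $ i) * (1\<^sub>m n - mat n n (\<lambda>(i, j). C i j)))"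
    then have ij: "i < n" "j < n" by (simp_all add: mat_diag_def)
    \<comment> \<open>Multiplication by \<open>D + S\<close> undoes the row scaling:
      \<open>(D + S) (I - C) = D + S - B = A + S\<close>.\<close>
    have "(a i + s $ i) * x i = 1" using x[OF ij(1)] by (auto simp: x_def)
    then have "(a i + s $ i) * C i j = B $$ (i, j)" by (simp add: C_def mult.assoc[symmetric])
    then show "(A + mat_diag n (\<lambda>i. s $ i)) $$ (i, j) =
        (mat_diag n (\<lambda>i. a i + s $ i) * (1\<^sub>m n - mat n n (\<lambda>(i, j). C i j))) $$ (i, j)"
      using ij A_carrier
      by (subst mat_diag_mult_left[of _ n n]) (auto simp: mat_diag_def B a_def right_diff_distrib)
  qed (use A_carrier in \<open>auto simp: mat_diag_def\<close>)
  moreover have "det (mat_diag n (\<lambda>i. a i + s $ i) * (1\<^sub>m n - mat n n (\<lambda>(i, j). C i j))) =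
      det (mat_diag n (\<lambda>i. a i + s $ i)) * d"
    unfolding d_def by (rule det_mult[of _ n]) auto
  ultimately have det_AS: "det (A + mat_diag n (\<lambda>i. s $ i)) = (\<Prod>i = 0..<n. a i + s $ i) * d"
    by (simp only: det_mat_diag)
  have prod_pos: "(\<Prod>i = 0..<n. a i + s $ i) > 0"
    using a s by (intro prod_pos) (simp add: add_pos_nonneg)
  \<comment> \<open>This is \<open>det (D + S) powr - \<alpha>\<close>, which combines with
    \<open>d powr - \<alpha>\<close> into the power of \<open>det (A + S)\<close>.\<close>
  have "(\<Prod>i = 0..<n. x i powr \<alpha>) = (\<Prod>i = 0..<n. a i + s $ i) powr - \<alpha>"
    using a s by (auto simp: x_def powr_minus powr_divide prod_powr_distrib prod_dividef
        inverse_eq_divide add_nonneg_nonneg less_imp_le intro!: prod.cong)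
  then have \<kappa>d: "\<kappa> * d powr (- \<alpha>) = det A powr \<alpha> / det (A + mat_diag n (\<lambda>i. s $ i)) powr \<alpha>"
    using prod_pos d unfolding \<kappa>_def det_AS by (simp add: powr_mult powr_minus field_simps)
  have "(\<integral>\<omega>. exp (- (\<Sum>i = 0..<n. s $ i * X \<omega> $ i)) \<partial>M) = enn2real L"
    unfolding L_def
  proof (rule integral_eq_nn_integral)
    \<comment> \<open>Since the index \<open>Z \<omega>\<close> varies, measurability is glued from
      the countably many values of \<open>Z\<close>.\<close>
    have "(\<lambda>\<omega>. exp (- (\<Sum>i = 0..<n. s $ i * \<xi> (Z \<omega>) i \<omega>))) \<in> borel_measurable M"
      using measurable_compose_countable'[OF _ Z_rv cnt, of "\<lambda>k \<omega>. exp (- (\<Sum>i = 0..<n. s $ i * \<xi> k i \<omega>))" borel]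
        \<xi>_meas by simp
    then show "(\<lambda>\<omega>. exp (- (\<Sum>i = 0..<n. s $ i * X \<omega> $ i))) \<in> borel_measurable M"
      by (rule measurable_cong[THEN iffD1, rotated]) (simp add: X_nth)
  qed simp
  then show "(\<integral>\<omega>. exp (- (\<Sum>i = 0..<n. s $ i * X \<omega> $ i)) \<partial>M) =
      det A powr \<alpha> / det (A + mat_diag n (\<lambda>i. s $ i)) powr \<alpha>"
    using \<kappa> by (simp add: L \<kappa>d[symmetric])
qed

end
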